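(* There exists $C<\infty$ such that, for every $n\ge1$ and every $1$-Lipschitz function $h:\mathbb R\to\mathbb R$, $$\left|\mathbb E[h(W_n)]-\mathbb E[h(Z_4)]-\frac1{\sqrt n}\mathbb E[\mathrm e_1(Z_4)h(Z_4)]\right|\le Cn^{-3/4},$$ where $$\mathrm e_1(x)=\frac{x^2}2-\frac{x^6}{30}-\frac15\mathbb E[Z_4^2].$$
   Context: Critical Curie–Weiss model: $\sigma=(\sigma_1,\dots,\sigma_n)\in\{-1,1\}^n$ is distributed with probability proportional to $\exp\big(\frac1{2n}(\sum_{i=1}^n\sigma_i)^2\big)$ (critical temperature, no external field; equivalently, conditionally on the other spins, $\sigma_i$ has mean $\tanh\big(\frac1n\sum_{k\ne i}\sigma_k\big)$). $W_n=n^{-3/4}\sum_{i=1}^n\sigma_i$. $Z_4$ is a real random variable with density $p_4(x)=C_4e^{-x^4/12}$, $x\in\mathbb R$, where $C_4$ is the normalizing constant; thus $\mathbb E[Z_4^2]=\sqrt{12}\,\Gamma(3/4)/\Gamma(1/4)$. *)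

theory Defs
  imports "HOL-Probability.Probability"
begin

text \<open>A configuration is an extensional function on \<open>{1..n}\<close> with values in \<open>{-1, 1}\<close>,
  so the configuration space is finite with \<open>2 ^ n\<close> elements.\<close>

definition spin_configs :: "nat \<Rightarrow> (nat \<Rightarrow> real) set" where
  "spin_configs n = (\<Pi>\<^sub>E i\<in>{1..n}. {-1, 1})"

definition total_spin :: "nat \<Rightarrow> (nat \<Rightarrow> real) \<Rightarrow> real" where
  "total_spin n \<sigma> = (\<Sum>i=1..n. \<sigma> i)"

definition cw_weight :: "nat \<Rightarrow> (nat \<Rightarrow> real) \<Rightarrow> real" where
  "cw_weight n \<sigma> = exp (1 / (2 * real n) * (total_spin n \<sigma>)\<^sup>2)"

definition cw_partition :: "nat \<Rightarrow> real" where
  "cw_partition n = (\<Sum>\<sigma>\<in>spin_configs n. cw_weight n \<sigma>)"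

definition curie_weiss :: "nat \<Rightarrow> (nat \<Rightarrow> real) measure" where
  "curie_weiss n =
     point_measure (spin_configs n) (\<lambda>\<sigma>. ennreal (cw_weight n \<sigma> / cw_partition n))"

definition W :: "nat \<Rightarrow> (nat \<Rightarrow> real) \<Rightarrow> real" where
  "W n \<sigma> = real n powr (- 3 / 4) * total_spin n \<sigma>"

definition C4 :: real where
  "C4 = 1 / (LINT x|lborel. exp (- (x ^ 4) / 12))"

definition p4 :: "real \<Rightarrow> real" where
  "p4 x = C4 * exp (- (x ^ 4) / 12)"

text \<open>The law of \<open>Z\<^sub>4\<close>. Only this law matters, so \<open>Z\<^sub>4\<close> is taken to be the identity on this
  probability space: the expectation of \<open>f(Z\<^sub>4)\<close> is the integral of \<open>f\<close> against \<open>Z4_law\<close>.\<close>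

definition Z4_law :: "real measure" where
  "Z4_law = density lborel (\<lambda>x. ennreal (p4 x))"

definition e1 :: "real \<Rightarrow> real" where
  "e1 x = x\<^sup>2 / 2 - x ^ 6 / 30 - 1 / 5 * (LINT z|Z4_law. z\<^sup>2)"

lemma finite_spin_configs: "finite (spin_configs n)"
  unfolding spin_configs_def by (intro finite_PiE) auto

lemma cw_partition_pos: "cw_partition n > 0"
proof -
  have "spin_configs n \<noteq> {}"
    by (simp add: spin_configs_def PiE_eq_empty_iff)
  then show ?thesis
    unfolding cw_partition_def
    by (intro sum_pos finite_spin_configs) (auto simp: cw_weight_def)
qed

lemma prob_space_curie_weiss: "prob_space (curie_weiss n)"
proof
  have "emeasure (curie_weiss n) (space (curie_weiss n))
      = (\<Sum>\<sigma>\<in>spin_configs n. ennreal (cw_weight n \<sigma> / cw_partition n))"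
    unfolding curie_weiss_def space_point_measure
    by (intro emeasure_point_measure_finite finite_spin_configs order_refl)
  also have "\<dots> = ennreal (\<Sum>\<sigma>\<in>spin_configs n. cw_weight n \<sigma> / cw_partition n)"
    using cw_partition_pos[of n]
    by (intro sum_ennreal) (auto simp: cw_weight_def)
  also have "(\<Sum>\<sigma>\<in>spin_configs n. cw_weight n \<sigma> / cw_partition n) = 1"
    using cw_partition_pos[of n]
    by (simp add: sum_divide_distrib[symmetric] cw_partition_def)
  finally show "emeasure (curie_weiss n) (space (curie_weiss n)) = 1"
    by simp
qed

lemma integrable_exp_quartic: "integrable lborel (\<lambda>x::real. exp (- (x ^ 4) / 12))"
proof (rule Bochner_Integration.integrable_bound)
  show "integrable lborel (\<lambda>x. exp (3 / 4) * sqrt (2 * pi) * std_normal_density x)"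
    by simp
  have "exp (- (x ^ 4) / 12) \<le> exp (3 / 4) * exp (- x\<^sup>2 / 2)" for x :: real
  proof -
    have "0 \<le> (x\<^sup>2 - 3)\<^sup>2" by simp
    also have "\<dots> = x ^ 4 - 6 * x\<^sup>2 + 9"
      by (simp add: power2_diff power_mult[symmetric])
    finally have "- (x ^ 4) / 12 \<le> 3 / 4 + - x\<^sup>2 / 2" by simp
    then show ?thesis by (simp add: exp_add[symmetric])
  qed
  then show "AE x in lborel. norm (exp (- (x ^ 4) / 12)) \<le>
      norm (exp (3 / 4) * sqrt (2 * pi) * std_normal_density x)"
    by (intro AE_I2) (simp add: std_normal_density_def abs_mult)
qed simp

lemma prob_space_Z4_law: "prob_space Z4_law"
proof -
  let ?f = "\<lambda>x::real. exp (- (x ^ 4) / 12)"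
  have "(LINT x|lborel. ?f x) \<noteq> 0"
  proof
    assume "(LINT x|lborel. ?f x) = 0"
    then have "AE x in lborel. ?f x = 0"
      using integral_nonneg_eq_0_iff_AE[OF integrable_exp_quartic] by simp
    then show False
      by (simp add: eventually_False ae_filter_eq_bot_iff)
  qed
  moreover have "(LINT x|lborel. ?f x) \<ge> 0"
    by (intro integral_nonneg_AE) simp
  ultimately have pos: "(LINT x|lborel. ?f x) > 0" by linarith
  have "(\<integral>\<^sup>+x. ennreal (p4 x) \<partial>lborel) = ennreal (LINT x|lborel. p4 x)"
    unfolding p4_def using integrable_exp_quartic pos
    by (intro nn_integral_eq_integral) (auto simp: C4_def)
  also have "(LINT x|lborel. p4 x) = 1"
    unfolding p4_def using pos by (simp add: C4_def)
  finally show ?thesis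
    unfolding Z4_law_def
    by (intro prob_spaceI) (simp add: emeasure_density p4_def cong: nn_integral_cong)
qed

end

theory Submission
  imports Defs
begin

text \<open>
  The total spin takes the value \<open>s = 2 k - n\<close> with weight \<open>a\<^sub>k = (n choose k) exp (s\<^sup>2 / (2 n))\<close>, and
  the increments of its logarithm are exactly \<open>ln a\<^sub>k\<^sub>+\<^sub>1 - ln a\<^sub>k = 2 t / n - 2 artanh (t / (n + 1))\<close>
  with \<open>t = s + 1\<close>. Expanding artanh and summing gives, for \<open>x = s n\<^bsup>-3/4\<^esup>\<close>, the local limit theorem
  \<open>a\<^sub>k / A = exp (- x\<^bsup>4\<^esup> / 12) (1 + (x\<^sup>2 / 2 - x\<^bsup>6\<^esup> / 30) / \<surd>n) + O (exp (- x\<^sup>2) / n)\<close>.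
  The bound \<open>n\<^bsup>-3/4\<^esup>\<close> is the lattice spacing: smearing every atom of \<open>W\<^sub>n\<close> uniformly over its cell
  costs \<open>O (n\<^bsup>-3/4\<^esup>)\<close> for a Lipschitz test function and yields a density that is comparable pointwise
  with the target. The constant in \<open>e\<^sub>1\<close> comes from normalisation, since
  \<open>E Z\<^bsup>6\<^esup> = 9 E Z\<^sup>2\<close> by partial integration.
\<close>

subsection \<open>Weights of the total spin\<close>

text \<open>The partition function is never estimated by itself. The local limit theorem fixes the
  weights only up to a factor \<open>A\<close> depending on \<open>n\<close>; the total mass is
  recovered at the end by integrating the pointwise comparison of densities. The obstacle is
  uniformity in \<open>x\<close>. The two-sided expansion of artanh is used only for total spins up
  to \<open>n / 2\<close>, and the correction \<open>x\<^sup>2 / 2 - x ^ 6 / 30\<close> is unbounded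
  below, so the exponential cannot be linearised naively. The remedy is a cruder one-sided bound,
  with \<open>x ^ 4 / 96\<close> in place of \<open>x ^ 4 / 12\<close>, that holds for every spin.
  Uniformity in \<open>h\<close> comes from subtracting \<open>h 0\<close>: what is left is bounded
  by the absolute value of \<open>x\<close>, and the constant cancels because both sides have total
  mass one.\<close>

text \<open>A configuration is determined by its set \<open>S\<close> of sites with spin 1, and its
  total spin is \<open>2 * card S - n\<close>. Grouping the subsets by cardinality produces the
  binomial coefficients.\<close>

lemma sum_spin_configs:
  fixes F :: "real \<Rightarrow> real"
  shows "(\<Sum>\<sigma>\<in>spin_configs n. F (total_spin n \<sigma>)) = (\<Sum>k\<le>n. real (n choose k) * F (2 * real k - real n))"
proof -
  let ?g = "\<lambda>S. F (2 * real (card S) - real n)"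
  have tot: "total_spin n \<sigma> = 2 * real (card {i\<in>{1..n}. \<sigma> i = 1}) - real n"
    if "\<sigma> \<in> spin_configs n" for \<sigma>
  proof -
    have "\<sigma> i = 2 * (if \<sigma> i = 1 then 1 else 0) - 1" if "i \<in> {1..n}" for i
      using \<open>\<sigma> \<in> spin_configs n\<close> that by (auto simp: spin_configs_def PiE_iff)
    then have "total_spin n \<sigma> = (\<Sum>i=1..n. 2 * (if \<sigma> i = 1 then 1 else 0) - 1)"
      unfolding total_spin_def by (intro sum.cong refl)
    then show ?thesis
      by (simp add: sum_subtractf sum_distrib_left[symmetric] sum.If_cases Int_def)
  qed
  have "(\<Sum>\<sigma>\<in>spin_configs n. F (total_spin n \<sigma>)) = (\<Sum>S\<in>Pow {1..n}. ?g S)"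
  proof (rule sum.reindex_bij_witness)
    show "(\<lambda>i. if i \<in> {1..n} then (if i \<in> {i \<in> {1..n}. \<sigma> i = 1} then 1 else -1) else undefined) = \<sigma>"
      if "\<sigma> \<in> spin_configs n" for \<sigma> :: "nat \<Rightarrow> real"
    proof
      fix i
      show "(if i \<in> {1..n} then (if i \<in> {i \<in> {1..n}. \<sigma> i = 1} then 1 else -1) else undefined) = \<sigma> i"
        using that by (cases "i \<in> {1..n}") (force simp: spin_configs_def PiE_iff extensional_def)+
    qed
  qed (auto simp: spin_configs_def tot split: if_splits)
  also have "\<dots> = (\<Sum>k\<le>n. \<Sum>S | S \<in> Pow {1..n} \<and> card S = k. ?g S)"
  proof (rule sum.group[symmetric])
    show "card ` Pow {1..n} \<subseteq> {..n}"
      using card_mono[of "{1..n}"] by auto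
  qed auto
  also have "\<dots> = (\<Sum>k\<le>n. real (n choose k) * F (2 * real k - real n))"
  proof (intro sum.cong refl)
    fix k
    have "card {S. S \<in> Pow {1..n} \<and> card S = k} = n choose k"
      using n_subsets[of "{1..n}" k] by (simp add: Pow_def)
    then show "(\<Sum>S | S \<in> Pow {1..n} \<and> card S = k. ?g S) = real (n choose k) * F (2 * real k - real n)"
      by simp
  qed
  finally show ?thesis .
qed

text \<open>Cutting the geometric series of the derivative \<open>1 / (1 - x\<^sup>2)\<close> after
  three terms leaves \<open>x ^ 6 / (1 - x\<^sup>2)\<close>, which is nonnegative.\<close>

lemma artanh_real_lower:
  fixes u :: real
  assumes "0 \<le> u" "u < 1"
  shows "u + u ^ 3 / 3 + u ^ 5 / 5 \<le> artanh u"
proof -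
  have "(\<lambda>u. artanh u - (u + u ^ 3 / 3 + u ^ 5 / 5)) 0 \<le> (\<lambda>u. artanh u - (u + u ^ 3 / 3 + u ^ 5 / 5)) u"
  proof (rule DERIV_nonneg_imp_nondecreasing[OF assms(1)])
    fix x assume x: "0 \<le> x" "x \<le> u"
    then have x2: "x\<^sup>2 < 1" using assms by (simp add: abs_square_less_1)
    have "((\<lambda>u. artanh u - (u + u ^ 3 / 3 + u ^ 5 / 5)) has_real_derivative
        (1 / (1 - x\<^sup>2) - (1 + x\<^sup>2 + x ^ 4))) (at x)"
      using x assms x2 by (auto intro!: derivative_eq_intros simp: field_simps)
    moreover have "1 / (1 - x\<^sup>2) - (1 + x\<^sup>2 + x ^ 4) = x ^ 6 / (1 - x\<^sup>2)"
      using x2 by (simp add: field_simps power_add[symmetric])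
    ultimately show "\<exists>y. ((\<lambda>u. artanh u - (u + u ^ 3 / 3 + u ^ 5 / 5)) has_real_derivative y) (at x) \<and> 0 \<le> y"
      using x2 by auto
  qed
  then show ?thesis by simp
qed

text \<open>The coefficient 1 of \<open>u ^ 7\<close>, instead of the Taylor coefficient 1/7, pays
  for the whole tail: the derivative of the difference has the sign of
  \<open>6 - 7 * x\<^sup>2\<close>, positive up to \<open>u = 1 / 2\<close>.\<close>

lemma artanh_real_upper:
  fixes u :: real
  assumes "0 \<le> u" "u \<le> 1 / 2"
  shows "artanh u \<le> u + u ^ 3 / 3 + u ^ 5 / 5 + u ^ 7"
proof -
  have "(\<lambda>u. u + u ^ 3 / 3 + u ^ 5 / 5 + u ^ 7 - artanh u) 0 \<le> (\<lambda>u. u + u ^ 3 / 3 + u ^ 5 / 5 + u ^ 7 - artanh u) u"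
  proof (rule DERIV_nonneg_imp_nondecreasing[OF assms(1)])
    fix x assume x: "0 \<le> x" "x \<le> u"
    then have "x\<^sup>2 \<le> (1/2)\<^sup>2" using assms by (intro power_mono) auto
    then have x2: "x\<^sup>2 \<le> 1/4" by (simp add: power2_eq_square)
    have "((\<lambda>u. u + u ^ 3 / 3 + u ^ 5 / 5 + u ^ 7 - artanh u) has_real_derivative
        (1 + x\<^sup>2 + x ^ 4 + 7 * x ^ 6 - 1 / (1 - x\<^sup>2))) (at x)"
      using x assms x2 by (auto intro!: derivative_eq_intros simp: field_simps)
    moreover have "1 + x\<^sup>2 + x ^ 4 + 7 * x ^ 6 - 1 / (1 - x\<^sup>2) = x ^ 6 * (6 - 7 * x\<^sup>2) / (1 - x\<^sup>2)"
      using x2 by (simp add: field_simps power_add[symmetric])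
    ultimately show "\<exists>y. ((\<lambda>u. u + u ^ 3 / 3 + u ^ 5 / 5 + u ^ 7 - artanh u) has_real_derivative y) (at x) \<and> 0 \<le> y"
      using x2 by auto
  qed
  then show ?thesis by simp
qed

definition spin_weight :: "nat \<Rightarrow> nat \<Rightarrow> real" where
  "spin_weight n k = real (n choose k) * exp (1 / (2 * real n) * (2 * real k - real n)\<^sup>2)"

lemma spin_weight_pos: "k \<le> n \<Longrightarrow> spin_weight n k > 0"
  by (simp add: spin_weight_def)

lemma spin_weight_symmetric: "k \<le> n \<Longrightarrow> spin_weight n (n - k) = spin_weight n k"
  by (simp add: spin_weight_def binomial_symmetric[of k n] power2_commute of_nat_diff)

text \<open>Here \<open>t\<close> is the midpoint between the total spins of \<open>k\<close> and
  \<open>Suc k\<close>. With \<open>u = t / (n + 1)\<close> the binomial ratio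
  \<open>(n - k) / (k + 1)\<close> equals \<open>(1 - u) / (1 + u)\<close>, whose logarithm is
  \<open>- 2 * artanh u\<close>; the denominator \<open>n + 1\<close> is the sum of
  \<open>n - k\<close> and \<open>k + 1\<close>. The squared spins differ by
  \<open>4 * t\<close>.\<close>

lemma ln_spin_weight_Suc:
  assumes "k < n"
  defines "t \<equiv> 2 * real k - real n + 1"
  shows "ln (spin_weight n (Suc k)) - ln (spin_weight n k) = 2 * t / n - 2 * artanh (t / (n + 1))"
proof -
  have n: "real n > 0" using assms by simp
  have "Suc k * (n choose Suc k) = (n - k) * (n choose k)"
    by (simp only: binomial_absorption binomial_absorb_comp)
  then have "real (Suc k) * real (n choose Suc k) = real (n - k) * real (n choose k)"
    by (metis of_nat_mult)
  then have "real (n choose Suc k) = real (n choose k) * ((real n - real k) / (1 + real k))"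
    using assms(1) by (simp add: field_simps of_nat_diff)
  moreover have "(real n - real k) / (1 + real k) = (1 - t / (n + 1)) / (1 + t / (n + 1))"
  proof -
    have "1 - t / (n + 1) = 2 / (n + 1) * (real n - real k)" "1 + t / (n + 1) = 2 / (n + 1) * (1 + real k)"
      by (simp_all add: t_def field_simps)
    then show ?thesis
      by (simp only: mult_divide_mult_cancel_left_if) (use n in simp)
  qed
  moreover have "1 / (2 * real n) * (2 * real (Suc k) - real n)\<^sup>2
      = 1 / (2 * real n) * (2 * real k - real n)\<^sup>2 + 2 * t / n"
    using n by (simp add: t_def field_simps power2_eq_square)
  ultimately have "spin_weight n (Suc k)
      = spin_weight n k * ((1 - t / (n + 1)) / (1 + t / (n + 1)) * exp (2 * t / n))"
    by (simp add: spin_weight_def exp_add)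
  moreover have pos: "1 - t / (n + 1) > 0" "1 + t / (n + 1) > 0"
    using assms(1) by (simp_all add: t_def field_simps)
  moreover have "spin_weight n k > 0" using assms by (intro spin_weight_pos) simp
  ultimately have "ln (spin_weight n (Suc k))
      = ln (spin_weight n k) + (ln (1 - t / (n + 1)) - ln (1 + t / (n + 1)) + 2 * t / n)"
    by (simp add: ln_mult ln_div)
  then show ?thesis
    using pos by (simp add: artanh_def ln_div diff_divide_distrib)
qed

text \<open>In terms of \<open>x = s n\<^bsup>-3/4\<^esup>\<close> this is \<open>- x\<^bsup>4\<^esup> / 12 + (x\<^sup>2 / 2 - x\<^bsup>6\<^esup> / 30) / \<surd>n\<close>.\<close>

definition spin_exponent :: "real \<Rightarrow> real \<Rightarrow> real" where
  "spin_exponent n s = - (s ^ 4) / (12 * n ^ 3) + s\<^sup>2 / (2 * n\<^sup>2) - s ^ 6 / (30 * n ^ 5)"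

text \<open>The price of replacing \<open>n + 1\<close>, the natural denominator in artanh, by
  \<open>n\<close>; the upper bound is Bernoulli's inequality for
  \<open>n / (n + 1)\<close>.\<close>

lemma inverse_power_diff_bounds:
  fixes n :: real
  assumes "n \<ge> 1"
  shows "0 \<le> 1 / n ^ j - 1 / (n + 1) ^ j" "1 / n ^ j - 1 / (n + 1) ^ j \<le> real j / n ^ Suc j"
proof -
  have "(n + 1) ^ j \<ge> n ^ j" using assms by (intro power_mono) auto
  then show "0 \<le> 1 / n ^ j - 1 / (n + 1) ^ j" using assms by (simp add: frac_le)
  have "1 + real j * (- 1 / (n + 1)) \<le> (1 + (- 1 / (n + 1))) ^ j"
    using assms by (intro Bernoulli_inequality) (auto simp: field_simps)
  also have "1 + (- 1 / (n + 1)) = n / (n + 1)" using assms by (simp add: field_simps)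
  finally have "1 - real j / (n + 1) \<le> n ^ j / (n + 1) ^ j" by (simp add: power_divide)
  moreover have "real j / (n + 1) \<le> real j / n" using assms by (intro divide_left_mono) auto
  ultimately have "(1 - n ^ j / (n + 1) ^ j) / n ^ j \<le> (real j / n) / n ^ j"
    using assms by (intro divide_right_mono) auto
  then show "1 / n ^ j - 1 / (n + 1) ^ j \<le> real j / n ^ Suc j"
    using assms by (simp add: diff_divide_distrib)
qed

text \<open>The powers 2, 4, 6 in \<open>spin_exponent\<close> have increments with leading terms
  \<open>4 * t\<close>, \<open>8 * t ^ 3\<close>, \<open>12 * t ^ 5\<close>. Matching them with
  \<open>2 * t / n - 2 * t / (n + 1)\<close> and with the cubic and quintic terms of artanh is the
  origin of the coefficients 1/2, 1/12, 1/30. The error collects the change from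
  \<open>n + 1\<close> to \<open>n\<close> (\<open>D1\<close>, \<open>D3\<close>,
  \<open>D5\<close>), the artanh tail \<open>R\<close>, and the lower powers of \<open>t\<close>
  (\<open>S\<close> and a multiple of \<open>t / n ^ 3\<close>).\<close>

lemma spin_exponent_step:
  fixes n t :: real
  assumes n: "n \<ge> 1" and t: "1 \<le> t" "t \<le> n" "t / (n + 1) \<le> 1 / 2"
  shows "\<bar>2 * t / n - 2 * artanh (t / (n + 1)) - (spin_exponent n (t + 1) - spin_exponent n (t - 1))\<bar>
    \<le> 3 * t / n ^ 3 + 6 * t ^ 3 / n ^ 4 + 2 * t ^ 7 / n ^ 7"
proof -
  define u where "u = t / (n + 1)"
  have u: "0 \<le> u" "u \<le> 1/2" using n t by (auto simp: u_def)
  define R where "R = artanh u - (u + u ^ 3 / 3 + u ^ 5 / 5)"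
  have "u ^ 7 \<le> (t / n) ^ 7" using n t unfolding u_def by (intro power_mono divide_left_mono) auto
  then have R: "0 \<le> R" "R \<le> t ^ 7 / n ^ 7"
    using artanh_real_lower[of u] artanh_real_upper[of u] u by (auto simp: R_def power_divide)
  define D1 where "D1 = t * (1 / n - 1 / (n + 1)) - t / n\<^sup>2"
  have D1: "- t / n ^ 3 \<le> D1" "D1 \<le> 0"
  proof -
    have nz: "n \<noteq> 0" "n + 1 \<noteq> 0" using n by auto
    have "D1 = - t / (n\<^sup>2 * (n + 1))"
    proof -
      have "t * (1 / n - 1 / m) - t / n\<^sup>2 = t * (m - n - m / n) / (n * m)" if "m \<noteq> 0" for m
        using nz that by (simp add: field_simps power2_eq_square)
      from this[OF nz(2)] have "D1 = t * (1 - (n + 1) / n) / (n * (n + 1))" by (simp add: D1_def)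
      also have "1 - (n + 1) / n = - 1 / n" using nz by (simp add: field_simps)
      finally show ?thesis using nz by (simp add: power2_eq_square)
    qed
    moreover have "t / (n\<^sup>2 * (n + 1)) \<le> t / n ^ 3"
      using n t by (intro divide_left_mono) (auto simp: power2_eq_square power3_eq_cube)
    ultimately show "- t / n ^ 3 \<le> D1" "D1 \<le> 0" using n t by auto
  qed
  define D3 where "D3 = t ^ 3 * (1 / n ^ 3 - 1 / (n + 1) ^ 3)"
  have D3: "0 \<le> D3" "D3 \<le> 3 * t ^ 3 / n ^ 4"
  proof -
    show "0 \<le> D3" using inverse_power_diff_bounds(1)[OF n, of 3] t unfolding D3_def by simp
    have "D3 \<le> t ^ 3 * (3 / n ^ 4)"
      unfolding D3_def using inverse_power_diff_bounds(2)[OF n, of 3] t by (intro mult_left_mono) simp_all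
    then show "D3 \<le> 3 * t ^ 3 / n ^ 4" by (simp add: mult.commute)
  qed
  define D5 where "D5 = t ^ 5 * (1 / n ^ 5 - 1 / (n + 1) ^ 5)"
  have D5: "0 \<le> D5" "D5 \<le> 5 * t ^ 3 / n ^ 4"
  proof -
    show "0 \<le> D5" using inverse_power_diff_bounds(1)[OF n, of 5] t unfolding D5_def by simp
    have "D5 \<le> t ^ 5 * (5 / n ^ 6)"
      unfolding D5_def using inverse_power_diff_bounds(2)[OF n, of 5] t by (intro mult_left_mono) simp_all
    also have "\<dots> = (t / n)\<^sup>2 * (5 * t ^ 3 / n ^ 4)"
      by (simp add: power_divide power_add[symmetric])
    also have "\<dots> \<le> 1 * (5 * t ^ 3 / n ^ 4)"
      using n t by (intro mult_right_mono power_le_one) auto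
    finally show "D5 \<le> 5 * t ^ 3 / n ^ 4" by simp
  qed
  define S where "S = (40 * t ^ 3 + 12 * t) / (30 * n ^ 5)"
  have S: "0 \<le> S" "S \<le> 2 * t ^ 3 / n ^ 4"
  proof -
    show "0 \<le> S" using n t by (simp add: S_def)
    have "t \<le> t ^ 3" using t(1) by (rule self_le_power) simp
    then have "S \<le> (60 * t ^ 3) / (30 * n ^ 4)"
      unfolding S_def using n t by (intro frac_le) (auto intro: power_increasing)
    then show "S \<le> 2 * t ^ 3 / n ^ 4" by simp
  qed
  have "spin_exponent n (t + 1) - spin_exponent n (t - 1)
     = - ((t + 1) ^ 4 - (t - 1) ^ 4) / (12 * n ^ 3) + ((t + 1)\<^sup>2 - (t - 1)\<^sup>2) / (2 * n\<^sup>2)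
       - ((t + 1) ^ 6 - (t - 1) ^ 6) / (30 * n ^ 5)"
    by (simp add: spin_exponent_def diff_divide_distrib)
  also have "(t + 1) ^ 4 - (t - 1) ^ 4 = 8 * t ^ 3 + 8 * t" by algebra
  also have "(t + 1)\<^sup>2 - (t - 1)\<^sup>2 = 4 * t" by algebra
  also have "(t + 1) ^ 6 - (t - 1) ^ 6 = 12 * t ^ 5 + (40 * t ^ 3 + 12 * t)" by algebra
  finally have inc: "spin_exponent n (t + 1) - spin_exponent n (t - 1)
     = - (2/3) * (t ^ 3 / n ^ 3) - (2/3) * (t / n ^ 3) + 2 * (t / n\<^sup>2) - (2/5) * (t ^ 5 / n ^ 5) - S"
    by (simp add: S_def add_divide_distrib diff_divide_distrib)
  have "2 * t / n - 2 * artanh u - (spin_exponent n (t + 1) - spin_exponent n (t - 1))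
    = 2 * D1 + (2/3) * D3 + (2/5) * D5 - 2 * R + (2/3) * (t / n ^ 3) + S"
    unfolding inc D1_def D3_def D5_def R_def by (simp add: u_def power_divide algebra_simps)
  moreover have "2 * t ^ 7 / n ^ 7 = 2 * (t ^ 7 / n ^ 7)" "6 * t ^ 3 / n ^ 4 = 6 * (t ^ 3 / n ^ 4)"
    "3 * t / n ^ 3 = 3 * (t / n ^ 3)" "t / n ^ 3 \<ge> 0" "t ^ 3 / n ^ 4 \<ge> 0" using n t by simp_all
  ultimately show ?thesis using D1 D3 D5 R S unfolding u_def[symmetric] abs_le_iff
    by linarith
qed

lemma central_spin: "2 * real (n - n div 2) - real n = 0 \<or> 2 * real (n - n div 2) - real n = 1"
proof -
  have "real n = 2 * real (n div 2) + real (n mod 2)"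
    by (metis mult_div_mod_eq of_nat_add of_nat_mult of_nat_numeral)
  then have "2 * real (n - n div 2) - real n = real (n mod 2)" by (simp add: of_nat_diff)
  then show ?thesis by auto
qed

text \<open>The index \<open>n - n div 2\<close> is the least \<open>k\<close> with nonnegative total spin \<open>2 k - n\<close>. Comparing with
  its weight makes Stirling's formula unnecessary: only increments of the logarithm are needed.\<close>

lemma ln_spin_weight_approx:
  assumes "n \<ge> 1" "n - n div 2 \<le> k" "2 * (2 * real k - real n) \<le> real n"
  defines "s \<equiv> 2 * real k - real n"
  shows "\<bar>ln (spin_weight n k) - ln (spin_weight n (n - n div 2))
      - (spin_exponent n s - spin_exponent n (2 * real (n - n div 2) - real n))\<bar>
    \<le> s\<^sup>2 / real n ^ 3 + s ^ 4 / real n ^ 4 + s ^ 8 / real n ^ 7"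
  using assms(2,3) unfolding s_def
proof (induction k rule: dec_induct)
  case base
  then show ?case by simp
next
  case (step k)
  define t where "t = 2 * real k - real n + 1"
  have t1: "t \<ge> 1" using step.hyps(1) by (simp add: t_def)
  have t2: "2 * (t + 1) \<le> n" using step.prems by (simp add: t_def)
  have kn: "k < n" using t2 t1 by (simp add: t_def)
  have n: "real n \<ge> 1" using assms(1) by simp
  have s: "2 * real (Suc k) - real n = t + 1" "2 * real k - real n = t - 1" by (simp_all add: t_def)
  have "t / (real n + 1) \<le> 1/2" using t2 n by (simp add: field_simps)
  then have st: "\<bar>2 * t / n - 2 * artanh (t / (real n + 1)) - (spin_exponent n (t + 1) - spin_exponent n (t - 1))\<bar>
    \<le> 3 * t / real n ^ 3 + 6 * t ^ 3 / real n ^ 4 + 2 * t ^ 7 / real n ^ 7"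
    using t1 t2 n by (intro spin_exponent_step) auto
  have IH: "\<bar>ln (spin_weight n k) - ln (spin_weight n (n - n div 2))
      - (spin_exponent n (t - 1) - spin_exponent n (2 * real (n - n div 2) - real n))\<bar>
    \<le> (t - 1)\<^sup>2 / real n ^ 3 + (t - 1) ^ 4 / real n ^ 4 + (t - 1) ^ 8 / real n ^ 7"
    using step.IH t2 unfolding s by simp
  \<comment> \<open>The three terms of the claimed bound are chosen so that their increments from
    \<open>t - 1\<close> to \<open>t + 1\<close> dominate the three error terms of a single
    step.\<close>
  have "3 * t / real n ^ 3 \<le> ((t + 1)\<^sup>2 - (t - 1)\<^sup>2) / real n ^ 3"
    using t1 by (intro divide_right_mono) (auto simp: power2_eq_square algebra_simps)
  moreover have "(t + 1) ^ 4 - (t - 1) ^ 4 = 8 * t ^ 3 + 8 * t" by algebra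
  then have "6 * t ^ 3 / real n ^ 4 \<le> ((t + 1) ^ 4 - (t - 1) ^ 4) / real n ^ 4"
    using t1 by (intro divide_right_mono) auto
  moreover have "(t + 1) ^ 8 - (t - 1) ^ 8 = 16 * t ^ 7 + 112 * t ^ 5 + 112 * t ^ 3 + 16 * t" by algebra
  then have "2 * t ^ 7 / real n ^ 7 \<le> ((t + 1) ^ 8 - (t - 1) ^ 8) / real n ^ 7"
    using t1 by (intro divide_right_mono) auto
  moreover have "ln (spin_weight n (Suc k)) - ln (spin_weight n k) = 2 * t / n - 2 * artanh (t / (real n + 1))"
    using ln_spin_weight_Suc[OF kn] by (simp add: t_def add.commute)
  ultimately show ?case
    using IH st unfolding s diff_divide_distrib abs_le_iff by linarith
qed

text \<open>This reaches up to \<open>k = n\<close> because only the lower bound for artanh enters.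
  The constant 96: \<open>n + 1 \<le> 2 * n\<close> gives \<open>u \<ge> t / (2 * n)\<close>, so
  \<open>2 * u ^ 3 / 3 \<ge> t ^ 3 / (12 * n ^ 3)\<close>, which is the leading increment of
  \<open>s ^ 4 / (96 * n ^ 3)\<close>. All terms linear in \<open>t\<close> fit into the increment
  \<open>4 * t / n\<^sup>2\<close> of the quadratic term.\<close>

lemma ln_spin_weight_upper:
  assumes "n \<ge> 1" "n - n div 2 \<le> k" "k \<le> n"
  defines "s \<equiv> 2 * real k - real n"
  shows "ln (spin_weight n k) \<le> ln (spin_weight n (n - n div 2)) + s\<^sup>2 / (real n)\<^sup>2 - s ^ 4 / (96 * real n ^ 3)"
  using assms(2,3) unfolding s_def
proof (induction k rule: dec_induct)
  case base
  define s where "s = 2 * real (n - n div 2) - real n"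
  have "s = 0 \<or> s = 1" unfolding s_def by (rule central_spin)
  moreover have "real n ^ 2 \<le> 96 * real n ^ 3"
    using power_increasing[of 2 3 "real n"] zero_le_power[of "real n" 3] assms(1) by linarith
  ultimately have "s ^ 4 / (96 * real n ^ 3) \<le> s\<^sup>2 / (real n)\<^sup>2"
    using assms(1) by (auto intro!: divide_left_mono)
  then show ?case by (simp add: s_def)
next
  case (step k)
  define t where "t = 2 * real k - real n + 1"
  define u where "u = t / (real n + 1)"
  have t1: "t \<ge> 1" using step.hyps(1) by (simp add: t_def)
  have kn: "k < n" using step.prems by simp
  have n: "real n \<ge> 1" using assms(1) by simp
  have s: "2 * real (Suc k) - real n = t + 1" "2 * real k - real n = t - 1" by (simp_all add: t_def)
  have u: "0 \<le> u" "u < 1" using t1 kn by (auto simp: u_def t_def field_simps)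
  have IH: "ln (spin_weight n k) \<le> ln (spin_weight n (n - n div 2)) + (t - 1)\<^sup>2 / (real n)\<^sup>2 - (t - 1) ^ 4 / (96 * real n ^ 3)"
    using step.IH kn unfolding s by simp
  have "u + u ^ 3 / 3 \<le> artanh u" using artanh_real_lower[OF u] u by (smt (verit) divide_nonneg_pos zero_le_power)
  moreover have "(t / (2 * n)) ^ 3 \<le> u ^ 3" unfolding u_def using n t1
    by (intro power_mono divide_left_mono) auto
  moreover have "2 * t / n - 2 * u \<le> 2 * (t / (real n)\<^sup>2)"
  proof -
    have "2 * t / n - 2 * u = 2 * (t / (n * (n + 1)))" using n by (simp add: u_def field_simps)
    also have "\<dots> \<le> 2 * (t / (real n)\<^sup>2)" using n t1
      by (intro mult_left_mono frac_le) (auto simp: power2_eq_square algebra_simps)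
    finally show ?thesis .
  qed
  moreover have "ln (spin_weight n (Suc k)) - ln (spin_weight n k) = 2 * t / n - 2 * artanh u"
    using ln_spin_weight_Suc[OF kn] by (simp add: t_def u_def add.commute)
  moreover have "t / real n ^ 3 \<le> t / (real n)\<^sup>2" using n t1 power_increasing[of 2 3 "real n"]
    by (intro divide_left_mono) auto
  moreover have "((t + 1)\<^sup>2 - (t - 1)\<^sup>2) / (real n)\<^sup>2 = 4 * (t / (real n)\<^sup>2)" by (simp add: power2_eq_square algebra_simps)
  moreover have "(t + 1) ^ 4 - (t - 1) ^ 4 = 8 * t ^ 3 + 8 * t" by algebra
  then have "((t + 1) ^ 4 - (t - 1) ^ 4) / (96 * real n ^ 3) = (1/12) * (t ^ 3 / real n ^ 3) + (1/12) * (t / real n ^ 3)"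
    by (simp add: add_divide_distrib)
  moreover have "(t / (2 * n)) ^ 3 = (1/8) * (t ^ 3 / real n ^ 3)" by (simp add: power_divide power_mult_distrib)
  moreover have "t / (real n)\<^sup>2 \<ge> 0" using t1 by simp
  ultimately show ?case
    using IH unfolding s diff_divide_distrib by linarith
qed

subsection \<open>Local limit theorem\<close>

text \<open>The inequality \<open>y / k \<le> exp (y / k)\<close> is raised to the power
  \<open>k\<close>; for \<open>k = 0\<close> the factor \<open>0 ^ 0\<close> is 1.\<close>

lemma power_le_power_times_exp:
  fixes y :: real
  assumes "y \<ge> 0"
  shows "y ^ k \<le> real k ^ k * exp y"
proof (cases "k = 0")
  case False
  have "y / k \<le> exp (y / k)" using exp_ge_add_one_self[of "y / k"] by linarith
  then have "(y / k) ^ k \<le> exp (y / k) ^ k" using assms by (intro power_mono) auto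
  also have "\<dots> = exp y" using False by (simp add: exp_of_nat_mult[symmetric])
  finally show ?thesis using False by (simp add: power_divide field_simps)
qed (use assms in simp)

lemma quartic_exp_dominates:
  assumes "c > 0"
  obtains C where "C > 0"
    "\<And>x::real. (1 + x\<^sup>2) ^ k * exp (a * x\<^sup>2 - c * x ^ 4) \<le> C * exp (- x\<^sup>2)"
proof
  define K where "K = (real k ^ k + 1) * exp (1 + (a + 2)\<^sup>2 / (4 * c))"
  show "K > 0" by (simp add: K_def add_nonneg_pos)
  fix x :: real
  \<comment> \<open>Completing the square in \<open>x\<^sup>2\<close>. In the coefficient
    \<open>a + 2\<close>, one unit pays for \<open>exp (1 + x\<^sup>2)\<close>, the majorant of the
    polynomial, and one for the Gaussian on the right.\<close>
  have "0 \<le> c * (x\<^sup>2 - (a + 2) / (2 * c))\<^sup>2" using assms by simp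
  also have "\<dots> = c * x ^ 4 - (a + 2) * x\<^sup>2 + (a + 2)\<^sup>2 / (4 * c)"
    using assms by (simp add: power2_eq_square power4_eq_xxxx field_simps)
  finally have sq: "(1 + x\<^sup>2) + (a * x\<^sup>2 - c * x ^ 4) \<le> (1 + (a + 2)\<^sup>2 / (4 * c)) + (- x\<^sup>2)"
    by (simp add: algebra_simps)
  have "(1 + x\<^sup>2) ^ k \<le> real k ^ k * exp (1 + x\<^sup>2)"
    by (rule power_le_power_times_exp) simp
  also have "\<dots> \<le> (real k ^ k + 1) * exp (1 + x\<^sup>2)" by (simp add: distrib_right)
  finally have "(1 + x\<^sup>2) ^ k * exp (a * x\<^sup>2 - c * x ^ 4)
      \<le> (real k ^ k + 1) * exp (1 + x\<^sup>2) * exp (a * x\<^sup>2 - c * x ^ 4)"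
    by (rule mult_right_mono) simp
  also have "\<dots> = (real k ^ k + 1) * exp ((1 + x\<^sup>2) + (a * x\<^sup>2 - c * x ^ 4))"
    by (simp only: exp_add mult.assoc)
  also have "\<dots> \<le> (real k ^ k + 1) * exp ((1 + (a + 2)\<^sup>2 / (4 * c)) + (- x\<^sup>2))"
    using sq by (intro mult_left_mono) auto
  also have "\<dots> = K * exp (- x\<^sup>2)" by (simp only: K_def exp_add mult.assoc)
  finally show "(1 + x\<^sup>2) ^ k * exp (a * x\<^sup>2 - c * x ^ 4) \<le> K * exp (- x\<^sup>2)" .
qed

lemma power_le_one_plus_square_power:
  fixes x :: real
  assumes "j \<le> 2 * k"
  shows "\<bar>x\<bar> ^ j \<le> (1 + x\<^sup>2) ^ k"
proof (cases "\<bar>x\<bar> \<le> 1")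
  case True
  then have "\<bar>x\<bar> ^ j \<le> 1" by (intro power_le_one) auto
  also have "1 \<le> (1 + x\<^sup>2) ^ k" by (intro one_le_power) auto
  finally show ?thesis .
next
  case False
  then have "\<bar>x\<bar> ^ j \<le> \<bar>x\<bar> ^ (2 * k)" using assms by (intro power_increasing) auto
  also have "\<dots> = (x\<^sup>2) ^ k" by (simp add: power_mult)
  also have "\<dots> \<le> (1 + x\<^sup>2) ^ k" by (intro power_mono) auto
  finally show ?thesis .
qed

lemma abs_exp_diff_le:
  fixes a b :: real
  assumes "a \<le> M" "b \<le> M"
  shows "\<bar>exp a - exp b\<bar> \<le> \<bar>a - b\<bar> * exp M"
proof -
  have *: "exp v - exp w \<le> (v - w) * exp M" if "w \<le> v" "v \<le> M" for v w :: real
  proof -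
    have "exp v - exp w = exp v * (1 - exp (w - v))" by (simp add: algebra_simps exp_diff)
    also have "1 - exp (w - v) \<le> v - w" using exp_ge_add_one_self[of "w - v"] by linarith
    also have "exp v * (v - w) \<le> exp M * (v - w)" using that by (intro mult_right_mono) auto
    finally show ?thesis by (simp add: mult.commute)
  qed
  show ?thesis
    using *[of a b] *[of b a] assms by (cases "a \<le> b") (auto simp: abs_if)
qed

text \<open>Only an upper bound on \<open>v\<close> is assumed, since \<open>v\<close> will be
  \<open>corr x / r\<^sup>2\<close>, which is unbounded below.\<close>

lemma abs_exp_taylor_one_le:
  fixes v M :: real
  assumes "v \<le> M" "0 \<le> M"
  shows "\<bar>exp v - 1 - v\<bar> \<le> v\<^sup>2 * exp M"
proof -
  obtain t where t: "\<bar>t\<bar> \<le> \<bar>v\<bar>" "exp v = (\<Sum>m<2. v ^ m / fact m) + exp t / fact 2 * v ^ 2"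
    using Maclaurin_exp_le[of v 2] by blast
  have "exp v - 1 - v = v\<^sup>2 * (exp t / 2)" using t(2) by (simp add: numeral_2_eq_2)
  show ?thesis
  proof (cases "v \<ge> 0")
    case True
    then have "exp t \<le> exp M" using t(1) assms by auto
    then have "exp t / 2 \<le> exp M" using exp_gt_zero[of t] by linarith
    then show ?thesis unfolding \<open>exp v - 1 - v = _\<close> abs_mult
      by (intro mult_mono) auto
  next
    case False
    \<comment> \<open>For negative \<open>v\<close> the Maclaurin point \<open>t\<close> may be
      positive, so \<open>exp t\<close> is not controlled by \<open>M\<close>. Instead the
      difference is nonincreasing on the negative half-line, its derivative at \<open>x\<close>
      being at most \<open>x\<close>.\<close>
    have "(\<lambda>v. v\<^sup>2 - (exp v - 1 - v)) 0 \<le> (\<lambda>v. v\<^sup>2 - (exp v - 1 - v)) v"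
    proof (rule DERIV_nonpos_imp_nonincreasing[where f = "\<lambda>v. v\<^sup>2 - (exp v - 1 - v)" and a = v and b = 0])
      fix x assume "v \<le> x" "x \<le> 0"
      moreover have "((\<lambda>v. v\<^sup>2 - (exp v - 1 - v)) has_real_derivative (2 * x - (exp x - 1))) (at x)"
        by (auto intro!: derivative_eq_intros)
      moreover have "1 + x \<le> exp x" by (rule exp_ge_add_one_self)
      ultimately show "\<exists>y. ((\<lambda>v. v\<^sup>2 - (exp v - 1 - v)) has_real_derivative y) (at x) \<and> y \<le> 0"
        by (intro exI[of _ "2 * x - (exp x - 1)"] conjI) (assumption, linarith)
    qed (use False in auto)
    then have "exp v - 1 - v \<le> v\<^sup>2" by simp
    then have "\<bar>exp v - 1 - v\<bar> \<le> v\<^sup>2 * 1" using exp_ge_add_one_self[of v] by linarith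
    also have "\<dots> \<le> v\<^sup>2 * exp M" using assms by (intro mult_left_mono) auto
    finally show ?thesis .
  qed
qed

text \<open>The function \<open>e1\<close> before centring; the constant is kept apart because it
  belongs to the normalisation.\<close>

definition corr :: "real \<Rightarrow> real" where
  "corr x = x\<^sup>2 / 2 - x ^ 6 / 30"

definition quartic :: "real \<Rightarrow> real" where
  "quartic x = exp (- (x ^ 4) / 12)"

text \<open>Throughout, \<open>r\<close> is the fourth root of \<open>n\<close>. Then the scale
  \<open>n powr (3 / 4)\<close> is \<open>r ^ 3\<close>, \<open>sqrt n\<close> is
  \<open>r\<^sup>2\<close>, and all scaling reduces to natural powers.\<close>

lemma spin_exponent_rescale:
  assumes "r > 0"
  shows "spin_exponent (r ^ 4) (x * r ^ 3) = - (x ^ 4) / 12 + corr x / r\<^sup>2"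
proof -
  have "(x * r ^ 3) ^ 4 / (12 * (r ^ 4) ^ 3) = x ^ 4 / 12"
    using assms by (simp add: power_mult_distrib power_mult[symmetric])
  moreover have "(x * r ^ 3)\<^sup>2 / (2 * (r ^ 4)\<^sup>2) = x\<^sup>2 / 2 / r\<^sup>2"
    using assms by (simp add: power_mult_distrib power_mult[symmetric] field_simps power_add[symmetric])
  moreover have "(x * r ^ 3) ^ 6 / (30 * (r ^ 4) ^ 5) = x ^ 6 / 30 / r\<^sup>2"
    using assms by (simp add: power_mult_distrib power_mult[symmetric] field_simps power_add[symmetric])
  ultimately show ?thesis
    unfolding spin_exponent_def corr_def diff_divide_distrib minus_divide_left[symmetric] by linarith
qed

lemma spin_exponent_minus [simp]: "spin_exponent n (- s) = spin_exponent n s"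
  by (simp add: spin_exponent_def)

lemma abs_corr_le: "\<bar>corr x\<bar> \<le> (1 + x\<^sup>2) ^ 3"
proof -
  have "\<bar>corr x\<bar> \<le> \<bar>x\<bar> ^ 2 / 2 + \<bar>x\<bar> ^ 6 / 30"
    by (simp add: corr_def power_even_abs abs_le_iff)
  also have "\<dots> \<le> (1 + x\<^sup>2) ^ 3 / 2 + (1 + x\<^sup>2) ^ 3 / 30"
    by (intro add_mono divide_right_mono power_le_one_plus_square_power) auto
  finally show ?thesis using zero_le_power[of "1 + x\<^sup>2" 3] by simp
qed

text \<open>The exponential of \<open>corr x / r\<^sup>2\<close> is expanded to first order. Since
  \<open>x ^ 6\<close> enters \<open>corr\<close> negatively, this quantity is at most
  \<open>x\<^sup>2\<close>, so quartic decay still dominates. The weak constant 1/96 lets this error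
  share a majorant with the error in the weights.\<close>

lemma exp_corr_approx:
  assumes "r \<ge> 1"
  shows "\<bar>exp (- (x ^ 4) / 12 + corr x / r\<^sup>2) - quartic x * (1 + corr x / r\<^sup>2)\<bar>
    \<le> (1 + x\<^sup>2) ^ 6 * exp (x\<^sup>2 - (1 / 96) * x ^ 4) / r ^ 4"
proof -
  have "1 \<le> r\<^sup>2" using assms by (rule one_le_power)
  then have "corr x / r\<^sup>2 \<le> (x\<^sup>2 / 2) / 1"
    by (intro frac_le) (auto simp: corr_def)
  then have up: "corr x / r\<^sup>2 \<le> x\<^sup>2" using zero_le_power2[of x] by linarith
  have "(corr x)\<^sup>2 \<le> ((1 + x\<^sup>2) ^ 3)\<^sup>2"
    using abs_corr_le[of x] by (metis abs_ge_zero power2_abs power_mono)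
  then have c2: "(corr x)\<^sup>2 \<le> (1 + x\<^sup>2) ^ 6" by (simp add: power_mult[symmetric])
  have "\<bar>exp (- (x ^ 4) / 12 + corr x / r\<^sup>2) - quartic x * (1 + corr x / r\<^sup>2)\<bar>
     = quartic x * \<bar>exp (corr x / r\<^sup>2) - 1 - corr x / r\<^sup>2\<bar>"
  proof -
    have "exp (- (x ^ 4) / 12 + corr x / r\<^sup>2) - quartic x * (1 + corr x / r\<^sup>2)
      = quartic x * (exp (corr x / r\<^sup>2) - 1 - corr x / r\<^sup>2)"
      unfolding exp_add quartic_def[symmetric] by (simp add: algebra_simps)
    then show ?thesis by (simp add: abs_mult quartic_def)
  qed
  also have "\<dots> \<le> quartic x * ((corr x / r\<^sup>2)\<^sup>2 * exp (x\<^sup>2))"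
    using up by (intro mult_left_mono abs_exp_taylor_one_le) (auto simp: quartic_def)
  also have "\<dots> = (corr x)\<^sup>2 * (quartic x * exp (x\<^sup>2)) / r ^ 4"
    by (simp add: power_divide power_mult[symmetric])
  also have "quartic x * exp (x\<^sup>2) = exp (x\<^sup>2 - (1 / 12) * x ^ 4)"
    by (simp add: quartic_def exp_add[symmetric])
  also have "(corr x)\<^sup>2 * exp (x\<^sup>2 - (1 / 12) * x ^ 4) / r ^ 4
      \<le> (1 + x\<^sup>2) ^ 6 * exp (x\<^sup>2 - (1 / 96) * x ^ 4) / r ^ 4"
    using c2 assms by (intro divide_right_mono mult_mono) auto
  finally show ?thesis .
qed

lemma root4_ge_one:
  fixes r :: real
  assumes "n \<ge> 1" "r > 0" "r ^ 4 = real n"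
  shows "r \<ge> 1"
  using assms power_less_one_iff[of r 4]
  by (metis less_eq_real_def linorder_not_le of_nat_1 of_nat_le_iff zero_less_numeral)

text \<open>Two exponents are compared: \<open>l\<close>, the logarithm of the rescaled weight, and
  \<open>L\<close>, its polynomial approximation. Both lie below a common \<open>M\<close>, so their
  difference times \<open>exp M\<close> bounds the difference of the exponentials.\<close>

lemma spin_weight_local_limit:
  obtains C where "C > 0" "\<And>n r. n \<ge> 1 \<Longrightarrow> r > 0 \<Longrightarrow> r ^ 4 = real n \<Longrightarrow>
    \<exists>A>0. \<forall>k\<le>n. \<forall>x. x * r ^ 3 = 2 * real k - real n \<longrightarrow>
      \<bar>spin_weight n k / A - quartic x * (1 + corr x / r\<^sup>2)\<bar> \<le> C * exp (- x\<^sup>2) / r ^ 4"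
proof -
  obtain K where K: "K > 0"
    "\<And>x::real. (1 + x\<^sup>2) ^ 6 * exp (1 * x\<^sup>2 - (1 / 96) * x ^ 4) \<le> K * exp (- x\<^sup>2)"
    using quartic_exp_dominates[of "1/96" 6 1] by auto
  define C where "C = (18 * exp 1 + 1) * K"
  show ?thesis
  proof
    show "C > 0" using K(1) by (simp add: C_def add_pos_pos)
    fix n :: nat and r :: real
    assume n: "n \<ge> 1" and r0: "r > 0" and rn: "r ^ 4 = real n"
    have r1: "r \<ge> 1" using n r0 rn by (rule root4_ge_one)
    define k0 where "k0 = n - n div 2"
    define s0 where "s0 = 2 * real k0 - real n"
    have "s0 = 0 \<or> s0 = 1" unfolding s0_def k0_def by (rule central_spin)
    then have L0: "spin_exponent n s0 \<le> 1"
    proof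
      have "real n ^ 2 \<ge> 1" using n by (intro one_le_power) auto
      then have "1 / (2 * (real n)\<^sup>2) \<le> 1" using frac_le[of 1 1 1 "2 * (real n)\<^sup>2"] by simp
      moreover have "0 \<le> 1 / (12 * real n ^ 3)" "0 \<le> 1 / (30 * real n ^ 5)" by simp_all
      moreover assume "s0 = 1"
      then have "spin_exponent n s0 = 1 / (2 * (real n)\<^sup>2) - 1 / (12 * real n ^ 3) - 1 / (30 * real n ^ 5)"
        by (simp add: spin_exponent_def)
      ultimately show ?thesis by linarith
    qed (simp add: spin_exponent_def)
    \<comment> \<open>The factor \<open>exp (- spin_exponent n s0)\<close> aligns both exponents at
      the central index, so that \<open>l - L\<close> below is exactly the quantity bounded in
      \<open>ln_spin_weight_approx\<close>.\<close>
    define A where "A = spin_weight n k0 * exp (- spin_exponent n s0)"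
    have k0: "k0 \<le> n" by (simp add: k0_def)
    have w0: "spin_weight n k0 > 0" using k0 by (rule spin_weight_pos)
    have A: "A > 0" using w0 by (simp add: A_def)
    have main: "\<bar>spin_weight n k / A - quartic x * (1 + corr x / r\<^sup>2)\<bar> \<le> C * exp (- x\<^sup>2) / r ^ 4"
      if k: "k0 \<le> k" "k \<le> n" and x: "x * r ^ 3 = 2 * real k - real n" for k x
    proof -
      define G where "G = (1 + x\<^sup>2) ^ 6 * exp (x\<^sup>2 - (1 / 96) * x ^ 4) / r ^ 4"
      define M where "M = 1 + (x\<^sup>2 - (1 / 96) * x ^ 4)"
      define l where "l = ln (spin_weight n k) - ln (spin_weight n k0) + spin_exponent n s0"
      define L where "L = spin_exponent n (x * r ^ 3)"
      have wk: "spin_weight n k > 0" using k(2) by (rule spin_weight_pos)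
      have l: "spin_weight n k / A = exp l"
        using wk w0 by (simp add: l_def A_def exp_add exp_diff exp_minus field_simps)
      have Leq: "L = - (x ^ 4) / 12 + corr x / r\<^sup>2"
        unfolding L_def rn[symmetric] using r0 by (rule spin_exponent_rescale)
      have r2: "1 \<le> r\<^sup>2" using r1 by (rule one_le_power)
      have xr: "x\<^sup>2 / r\<^sup>2 \<le> x\<^sup>2" using frac_le[of "x\<^sup>2" "x\<^sup>2" 1 "r\<^sup>2"] r2 by simp
      have lM: "l \<le> M"
      proof -
        have "ln (spin_weight n k) - ln (spin_weight n k0)
          \<le> (x * r ^ 3)\<^sup>2 / (r ^ 4)\<^sup>2 - (x * r ^ 3) ^ 4 / (96 * (r ^ 4) ^ 3)"
          using ln_spin_weight_upper[OF n, of k] k unfolding x rn k0_def by simp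
        also have "(x * r ^ 3)\<^sup>2 / (r ^ 4)\<^sup>2 = x\<^sup>2 / r\<^sup>2" using r0
          by (simp add: power_mult_distrib power_mult[symmetric] field_simps power_add[symmetric])
        also have "(x * r ^ 3) ^ 4 / (96 * (r ^ 4) ^ 3) = x ^ 4 / 96" using r0
          by (simp add: power_mult_distrib power_mult[symmetric])
        finally show ?thesis using xr L0 by (simp add: l_def M_def)
      qed
      have LM: "L \<le> M"
      proof -
        have "0 \<le> x ^ 6" by simp
        then have "corr x \<le> x\<^sup>2" using zero_le_power2[of x] unfolding corr_def by linarith
        then have "corr x / r\<^sup>2 \<le> x\<^sup>2 / r\<^sup>2" by (intro divide_right_mono) auto
        moreover have "0 \<le> x ^ 4" by simp
        ultimately show ?thesis using xr unfolding Leq M_def by linarith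
      qed
      have r4: "r ^ 4 > 0" using r0 by simp
      have pw: "x ^ j \<le> (1 + x\<^sup>2) ^ 6" if "j \<le> 12" "even j" for j
        using power_le_one_plus_square_power[of j 6 x] that by (simp add: power_even_abs)
      have eM: "exp M = exp 1 * exp (x\<^sup>2 - (1 / 96) * x ^ 4)" by (simp only: M_def exp_add)
      have "\<bar>exp l - exp L\<bar> \<le> 18 * ((1 + x\<^sup>2) ^ 6 / r ^ 4) * exp M"
      proof (cases "2 * (2 * real k - real n) \<le> real n")
        case True
        have "\<bar>l - L\<bar> \<le> (x * r ^ 3)\<^sup>2 / (r ^ 4) ^ 3 + (x * r ^ 3) ^ 4 / (r ^ 4) ^ 4 + (x * r ^ 3) ^ 8 / (r ^ 4) ^ 7"
          using ln_spin_weight_approx[OF n, of k] k True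
          unfolding x rn k0_def l_def L_def s0_def by (simp add: algebra_simps)
        also have "(x * r ^ 3)\<^sup>2 / (r ^ 4) ^ 3 = x\<^sup>2 / r ^ 6" using r0
          by (simp add: power_mult_distrib power_mult[symmetric] field_simps power_add[symmetric])
        also have "(x * r ^ 3) ^ 4 / (r ^ 4) ^ 4 = x ^ 4 / r ^ 4" using r0
          by (simp add: power_mult_distrib power_mult[symmetric] field_simps power_add[symmetric])
        also have "(x * r ^ 3) ^ 8 / (r ^ 4) ^ 7 = x ^ 8 / r ^ 4" using r0
          by (simp add: power_mult_distrib power_mult[symmetric] field_simps power_add[symmetric])
        also have "x\<^sup>2 / r ^ 6 \<le> x\<^sup>2 / r ^ 4"
          using r1 r0 by (intro divide_left_mono power_increasing) auto
        also have "x\<^sup>2 / r ^ 4 + x ^ 4 / r ^ 4 + x ^ 8 / r ^ 4 = (x\<^sup>2 + x ^ 4 + x ^ 8) / r ^ 4"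
          by (simp add: add_divide_distrib)
        also have "\<dots> \<le> (18 * (1 + x\<^sup>2) ^ 6) / r ^ 4"
        proof (intro divide_right_mono)
          have one: "1 \<le> (1 + x\<^sup>2) ^ 6" by (intro one_le_power) auto
          have "a + b + c \<le> 18 * q" if "1 \<le> q" "a \<le> q" "b \<le> q" "c \<le> q" for a b c q :: real
            using that by linarith
          from this[OF one pw pw pw] show "x\<^sup>2 + x ^ 4 + x ^ 8 \<le> 18 * (1 + x\<^sup>2) ^ 6" by simp
        qed (use r4 in simp)
        finally have "\<bar>l - L\<bar> * exp M \<le> 18 * ((1 + x\<^sup>2) ^ 6 / r ^ 4) * exp M"
          by (intro mult_right_mono) auto
        then show ?thesis using abs_exp_diff_le[OF lM LM] by linarith
      next
        case False
        \<comment> \<open>Beyond half of the maximal spin nothing is expanded: there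
          \<open>16 * x ^ 4\<close> is at least \<open>r ^ 4\<close>, so the trivial bound
          \<open>exp M\<close> already has the required form.\<close>
        then have "r ^ 4 \<le> 2 * (x * r ^ 3)" using x rn by simp
        then have "(r ^ 4) ^ 4 \<le> (2 * (x * r ^ 3)) ^ 4" using r0 by (intro power_mono) auto
        then have "r ^ 12 * r ^ 4 \<le> r ^ 12 * (16 * x ^ 4)"
          by (simp add: power_mult_distrib power_mult[symmetric] power_add[symmetric] mult_ac)
        then have "r ^ 4 \<le> 16 * x ^ 4" by (rule mult_left_le_imp_le) (use r0 in simp)
        also have "\<dots> \<le> 18 * (1 + x\<^sup>2) ^ 6" using pw[of 4] by (intro mult_mono) auto
        finally have "1 \<le> 18 * ((1 + x\<^sup>2) ^ 6 / r ^ 4)" using r4 by (simp add: field_simps)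
        then have "1 * exp M \<le> 18 * ((1 + x\<^sup>2) ^ 6 / r ^ 4) * exp M" by (intro mult_right_mono) auto
        moreover have "exp l \<le> exp M" "exp L \<le> exp M" using lM LM by auto
        then have "\<bar>exp l - exp L\<bar> \<le> exp M" using exp_gt_zero[of l] exp_gt_zero[of L] by linarith
        ultimately show ?thesis by linarith
      qed
      also have "\<dots> = 18 * exp 1 * G" by (simp add: G_def eM)
      finally have "\<bar>exp l - exp L\<bar> \<le> 18 * exp 1 * G" .
      moreover have "\<bar>exp L - quartic x * (1 + corr x / r\<^sup>2)\<bar> \<le> G"
        unfolding Leq G_def using r1 by (rule exp_corr_approx)
      ultimately have "\<bar>exp l - quartic x * (1 + corr x / r\<^sup>2)\<bar> \<le> (18 * exp 1 + 1) * G"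
        unfolding distrib_right by linarith
      also have "\<dots> \<le> (18 * exp 1 + 1) * (K * exp (- x\<^sup>2) / r ^ 4)"
        using K(2)[of x] r4 unfolding G_def
        by (intro mult_left_mono divide_right_mono) (auto simp: add_nonneg_nonneg)
      finally show ?thesis unfolding l C_def by simp
    qed
    show "\<exists>A>0. \<forall>k\<le>n. \<forall>x. x * r ^ 3 = 2 * real k - real n \<longrightarrow>
      \<bar>spin_weight n k / A - quartic x * (1 + corr x / r\<^sup>2)\<bar> \<le> C * exp (- x\<^sup>2) / r ^ 4"
    proof (intro exI[of _ A] conjI A allI impI)
      fix k x assume k: "k \<le> n" and x: "x * r ^ 3 = 2 * real k - real n"
      show "\<bar>spin_weight n k / A - quartic x * (1 + corr x / r\<^sup>2)\<bar> \<le> C * exp (- x\<^sup>2) / r ^ 4"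
      proof (cases "k0 \<le> k")
        case True
        then show ?thesis using main k x by blast
      next
        case False
        \<comment> \<open>Negative total spins follow by flipping all spins, as
          \<open>quartic\<close> and \<open>corr\<close> are even.\<close>
        then have "k0 \<le> n - k" unfolding k0_def by linarith
        moreover have "(- x) * r ^ 3 = 2 * real (n - k) - real n" using k x by (simp add: of_nat_diff)
        ultimately have "\<bar>spin_weight n (n - k) / A - quartic (- x) * (1 + corr (- x) / r\<^sup>2)\<bar> \<le> C * exp (- (- x)\<^sup>2) / r ^ 4"
          by (intro main) auto
        then show ?thesis using k by (simp add: spin_weight_symmetric quartic_def corr_def)
      qed
    qed
  qed
qed

subsection \<open>Moments of the quartic law\<close>

text \<open>Later error bounds use \<open>exp (- x\<^sup>2 / 2)\<close> because it is the standard
  normal density up to the factor \<open>sqrt (2 * pi)\<close>.\<close>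

lemma integrable_gaussian_moment:
  "integrable lborel (\<lambda>x::real. \<bar>x\<bar> ^ k * exp (- x\<^sup>2 / 2))"
proof -
  have "integrable lborel (\<lambda>x::real. sqrt (2 * pi) * (std_normal_density x * \<bar>x\<bar> ^ k))"
    by (intro integrable_mult_right integrable_std_normal_moment_abs)
  then show ?thesis by (simp add: std_normal_density_def mult.commute)
qed

lemma gaussian_dominated:
  fixes g :: "real \<Rightarrow> real"
  assumes [measurable]: "g \<in> borel_measurable borel"
    and bound: "\<And>x. \<bar>g x\<bar> \<le> K * (\<bar>x\<bar> ^ k * exp (- x\<^sup>2 / 2))"
  shows integrable_gaussian_dominated: "integrable lborel g"
    and integral_gaussian_dominated:
      "\<bar>LINT x|lborel. g x\<bar> \<le> K * (LINT x|lborel. \<bar>x\<bar> ^ k * exp (- x\<^sup>2 / 2))"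
proof -
  have G: "integrable lborel (\<lambda>x. K * (\<bar>x\<bar> ^ k * exp (- x\<^sup>2 / 2)))"
    by (intro integrable_mult_right integrable_gaussian_moment)
  have le: "\<bar>g x\<bar> \<le> \<bar>K * (\<bar>x\<bar> ^ k * exp (- x\<^sup>2 / 2))\<bar>" for x
    using bound[of x] by linarith
  show int: "integrable lborel g"
    by (rule Bochner_Integration.integrable_bound[OF G]) (use le in auto)
  have "\<bar>LINT x|lborel. g x\<bar> \<le> (LINT x|lborel. \<bar>g x\<bar>)" by (rule integral_abs_bound)
  also have "\<dots> \<le> (LINT x|lborel. K * (\<bar>x\<bar> ^ k * exp (- x\<^sup>2 / 2)))"
    using int G bound by (intro integral_mono) auto
  finally show "\<bar>LINT x|lborel. g x\<bar> \<le> K * (LINT x|lborel. \<bar>x\<bar> ^ k * exp (- x\<^sup>2 / 2))" by simp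
qed

lemma quartic_poly_dominated:
  obtains C where "C > 0" "\<And>x. (1 + x\<^sup>2) ^ k * quartic x \<le> C * exp (- x\<^sup>2)"
  using quartic_exp_dominates[of "1/12" k 0] by (auto simp: quartic_def)

lemma quartic_measurable [measurable]: "quartic \<in> borel_measurable borel"
  unfolding quartic_def by measurable

lemma corr_measurable [measurable]: "corr \<in> borel_measurable borel"
  unfolding corr_def by measurable

lemma quartic_pos: "quartic x > 0"
  by (simp add: quartic_def)

lemma integrable_quartic_power: "integrable lborel (\<lambda>x. quartic x * x ^ j)"
proof -
  obtain C where C: "\<And>x. (1 + x\<^sup>2) ^ j * quartic x \<le> C * exp (- x\<^sup>2)" "C > 0"
    using quartic_poly_dominated[of j] by metis
  show ?thesis
  proof (rule integrable_gaussian_dominated)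
    fix x :: real
    have "\<bar>quartic x * x ^ j\<bar> = \<bar>x\<bar> ^ j * quartic x"
      using quartic_pos[of x] by (simp add: abs_mult power_abs)
    also have "\<dots> \<le> (1 + x\<^sup>2) ^ j * quartic x"
      using quartic_pos[of x] by (intro mult_right_mono power_le_one_plus_square_power) auto
    also have "\<dots> \<le> C * exp (- x\<^sup>2)" by (rule C)
    also have "\<dots> \<le> C * exp (- x\<^sup>2 / 2)" using C(2) by simp
    finally show "\<bar>quartic x * x ^ j\<bar> \<le> C * (\<bar>x\<bar> ^ 0 * exp (- x\<^sup>2 / 2))" by simp
  qed simp
qed

text \<open>Supplies the boundary terms of the partial integration for the sixth moment.\<close>

lemma cubic_quartic_vanishes: "((\<lambda>x. x ^ 3 * quartic x) \<longlongrightarrow> 0) at_infinity"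
proof -
  obtain C where C: "\<And>x. (1 + x\<^sup>2) ^ 2 * quartic x \<le> C * exp (- x\<^sup>2)" "C > 0"
    using quartic_poly_dominated[of 2] by metis
  show ?thesis
  proof (rule tendsto_0_le[where K = C])
    show "(inverse \<longlongrightarrow> (0::real)) at_infinity" by (rule tendsto_inverse_0)
    show "\<forall>\<^sub>F x in at_infinity. norm (x ^ 3 * quartic x) \<le> norm (inverse x) * C"
      unfolding eventually_at_infinity
    proof (intro exI[of _ 1] allI impI)
      fix x :: real assume "1 \<le> norm x"
      then have x: "\<bar>x\<bar> \<ge> 1" by simp
      have "\<bar>x\<bar> ^ 3 * quartic x * \<bar>x\<bar> = \<bar>x\<bar> ^ 4 * quartic x" by (simp add: power_Suc2[symmetric] eval_nat_numeral)
      also have "\<dots> \<le> (1 + x\<^sup>2) ^ 2 * quartic x"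
        using quartic_pos[of x] by (intro mult_right_mono power_le_one_plus_square_power) auto
      also have "\<dots> \<le> C * exp (- x\<^sup>2)" by (rule C)
      also have "\<dots> \<le> C * 1" using C(2) by (intro mult_left_mono) auto
      finally show "norm (x ^ 3 * quartic x) \<le> norm (inverse x) * C"
        using x quartic_pos[of x] by (simp add: abs_mult power_abs field_simps)
    qed
  qed
qed

text \<open>The derivative of \<open>x ^ 3 * quartic x\<close> is
  \<open>quartic x * (3 * x\<^sup>2 - x ^ 6 / 3)\<close>, and its integral over the line
  vanishes.\<close>

lemma quartic_moment_recursion:
  "(LINT x|lborel. quartic x * x ^ 6) = 9 * (LINT x|lborel. quartic x * x\<^sup>2)"
proof -
  let ?f = "\<lambda>x. 3 * (quartic x * x\<^sup>2) - (1/3) * (quartic x * x ^ 6)"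
  have int: "integrable lborel ?f"
    by (intro Bochner_Integration.integrable_diff integrable_mult_right integrable_quartic_power)
  have "(LBINT x=-\<infinity>..\<infinity>. ?f x) = 0 - 0"
  proof (rule interval_integral_FTC_integrable[where F = "\<lambda>x. x ^ 3 * quartic x"])
    show "((\<lambda>x. x ^ 3 * quartic x) has_vector_derivative ?f x) (at x)" for x
      unfolding has_real_derivative_iff_has_vector_derivative[symmetric] quartic_def
      by (auto intro!: derivative_eq_intros simp: field_simps power_add[symmetric])
    show "isCont ?f x" for x unfolding quartic_def by (auto intro!: continuous_intros)
    show "set_integrable lborel (einterval (-\<infinity>) \<infinity>) ?f"
      using int by (simp add: set_integrable_def)
    have "((\<lambda>x. x ^ 3 * quartic x) \<longlongrightarrow> 0) at_bot" "((\<lambda>x. x ^ 3 * quartic x) \<longlongrightarrow> 0) at_top"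
      using cubic_quartic_vanishes at_bot_le_at_infinity at_top_le_at_infinity tendsto_mono by blast+
    then show "(((\<lambda>x. x ^ 3 * quartic x) \<circ> real_of_ereal) \<longlongrightarrow> 0) (at_right (-\<infinity>))"
      "(((\<lambda>x. x ^ 3 * quartic x) \<circ> real_of_ereal) \<longlongrightarrow> 0) (at_left \<infinity>)"
      by (simp_all add: ereal_tendsto_simps1)
  qed simp
  then have "(LINT x|lborel. ?f x) = 0"
    by (simp add: interval_lebesgue_integral_def set_lebesgue_integral_def)
  also have "(LINT x|lborel. ?f x) = 3 * (LINT x|lborel. quartic x * x\<^sup>2) - (1/3) * (LINT x|lborel. quartic x * x ^ 6)"
    by (simp only: Bochner_Integration.integral_diff[OF integrable_mult_right integrable_mult_right]
        integrable_quartic_power integral_mult_right_zero)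
  finally show ?thesis by simp
qed

lemma quartic_integral_pos: "(LINT x|lborel. quartic x) > 0"
proof -
  have "integrable lborel quartic" using integrable_quartic_power[of 0] by simp
  moreover have "\<not> (AE x in lborel. quartic x = 0)"
    using quartic_pos by (simp add: less_imp_neq[symmetric] eventually_False ae_filter_eq_bot_iff)
  ultimately have "(LINT x|lborel. quartic x) \<noteq> 0"
    using integral_nonneg_eq_0_iff_AE[of lborel quartic] quartic_pos by (simp add: less_imp_le)
  moreover have "(LINT x|lborel. quartic x) \<ge> 0"
    using quartic_pos by (intro integral_nonneg_AE) (simp add: less_imp_le)
  ultimately show ?thesis by linarith
qed

lemma p4_quartic: "p4 x = quartic x / (LINT x|lborel. quartic x)"
  by (simp add: p4_def C4_def quartic_def)

lemma integral_Z4_law: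
  assumes "g \<in> borel_measurable borel"
  shows "(LINT z|Z4_law. g z) = (LINT x|lborel. quartic x * g x) / (LINT x|lborel. quartic x)"
proof -
  have "p4 \<in> borel_measurable borel" unfolding p4_quartic[abs_def] by measurable
  moreover have "p4 x \<ge> 0" for x
    using quartic_pos[of x] quartic_integral_pos by (simp add: p4_quartic)
  ultimately have "(LINT z|Z4_law. g z) = (LINT x|lborel. p4 x * g x)"
    unfolding Z4_law_def using assms by (subst integral_density) auto
  then show ?thesis by (simp add: p4_quartic)
qed

lemma integral_curie_weiss:
  "(LINT \<sigma>|curie_weiss n. h (W n \<sigma>))
    = (\<Sum>k\<le>n. spin_weight n k * h (real n powr (- 3 / 4) * (2 * real k - real n))) / (\<Sum>k\<le>n. spin_weight n k)"
proof -
  have Z: "cw_partition n = (\<Sum>k\<le>n. spin_weight n k)"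
    unfolding cw_partition_def cw_weight_def spin_weight_def by (rule sum_spin_configs)
  have "(LINT \<sigma>|curie_weiss n. h (W n \<sigma>))
      = (\<Sum>\<sigma>\<in>spin_configs n. cw_weight n \<sigma> / cw_partition n * h (W n \<sigma>))"
    unfolding curie_weiss_def using cw_partition_pos[of n]
    by (subst lebesgue_integral_point_measure_finite) (auto simp: finite_spin_configs cw_weight_def)
  also have "\<dots> = (\<Sum>k\<le>n. real (n choose k) * (exp (1 / (2 * real n) * (2 * real k - real n)\<^sup>2) / cw_partition n
      * h (real n powr (- 3 / 4) * (2 * real k - real n))))"
    unfolding cw_weight_def W_def by (rule sum_spin_configs)
  finally show ?thesis
    by (simp add: Z spin_weight_def sum_divide_distrib mult.assoc)
qed

subsection \<open>Comparison of densities\<close>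

text \<open>Neither normalised nor centred, and negative for large \<open>x\<close>: this is the
  form in which the local limit theorem delivers it.\<close>

definition target :: "real \<Rightarrow> real \<Rightarrow> real" where
  "target r x = quartic x * (1 + corr x / r\<^sup>2)"

lemma target_measurable [measurable]: "target r \<in> borel_measurable borel"
  unfolding target_def by measurable

text \<open>Needed where the smeared density is zero because \<open>x\<close> lies beyond all atoms.
  There \<open>r ^ 3\<close> is at most the third power of the absolute value of \<open>x\<close>,
  and the decay of \<open>quartic\<close> pays for it.\<close>

lemma target_tail:
  obtains C where "C > 0" "\<And>r x. r \<ge> 1 \<Longrightarrow> \<bar>x\<bar> \<ge> r \<Longrightarrow> \<bar>target r x\<bar> \<le> C * exp (- x\<^sup>2) / r ^ 3"
proof -
  obtain C where C: "C > 0" "\<And>x. (1 + x\<^sup>2) ^ 5 * quartic x \<le> C * exp (- x\<^sup>2)"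
    using quartic_poly_dominated[of 5] by metis
  show ?thesis
  proof
    show "2 * C > 0" using C by simp
    fix r x :: real assume r: "r \<ge> 1" and x: "\<bar>x\<bar> \<ge> r"
    have "r\<^sup>2 \<ge> 1" using r by simp
    have "\<bar>corr x / r\<^sup>2\<bar> \<le> \<bar>corr x\<bar> / 1" unfolding abs_divide
      using \<open>r\<^sup>2 \<ge> 1\<close> by (intro frac_le) auto
    moreover have "1 \<le> (1 + x\<^sup>2) ^ 3" by (intro one_le_power) auto
    ultimately have t: "\<bar>1 + corr x / r\<^sup>2\<bar> \<le> 2 * (1 + x\<^sup>2) ^ 3" using abs_corr_le[of x] by linarith
    have "r ^ 3 \<le> \<bar>x\<bar> ^ 3" using r x by (intro power_mono) auto
    also have "\<dots> \<le> (1 + x\<^sup>2) ^ 2" by (rule power_le_one_plus_square_power) simp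
    finally have "r ^ 3 \<le> (1 + x\<^sup>2) ^ 2" .
    then have "r ^ 3 * \<bar>target r x\<bar> \<le> (1 + x\<^sup>2) ^ 2 * (quartic x * (2 * (1 + x\<^sup>2) ^ 3))"
      unfolding target_def abs_mult using t quartic_pos[of x] r
      by (intro mult_mono) (auto intro: mult_nonneg_nonneg)
    also have "\<dots> = 2 * ((1 + x\<^sup>2) ^ 5 * quartic x)" by (simp add: power_add[symmetric])
    also have "\<dots> \<le> 2 * (C * exp (- x\<^sup>2))" by (intro mult_left_mono C) simp
    finally show "\<bar>target r x\<bar> \<le> 2 * C * exp (- x\<^sup>2) / r ^ 3" using r by (simp add: field_simps)
  qed
qed

text \<open>Moves Gaussian decay from an atom \<open>z\<close> to a point \<open>x\<close> of its
  cell, at the price of halving the exponent: \<open>x\<^sup>2 / 2 - z\<^sup>2 = (x - z)\<^sup>2 -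
  (x - 2 * z)\<^sup>2 / 2\<close>.\<close>

lemma exp_minus_square_shift:
  fixes x z :: real
  assumes "\<bar>x - z\<bar> \<le> 1"
  shows "exp (- z\<^sup>2) \<le> exp 1 * exp (- x\<^sup>2 / 2)"
proof -
  have "(x - z)\<^sup>2 \<le> 1" using assms by (simp add: abs_square_le_1)
  moreover have "0 \<le> (x - 2 * z)\<^sup>2" by simp
  ultimately have "- z\<^sup>2 \<le> 1 + - x\<^sup>2 / 2" by (simp add: power2_eq_square algebra_simps)
  then show ?thesis by (simp only: exp_add[symmetric] exp_le_cancel_iff)
qed

text \<open>The derivative is \<open>quartic\<close> times a polynomial of degree 9 with
  coefficients bounded uniformly in \<open>r \<ge> 1\<close>, hence dominated by a Gaussian. The
  restriction to distance 1 allows that Gaussian to be evaluated at \<open>x\<close>.\<close>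

lemma target_local_lipschitz:
  obtains C where "C > 0" "\<And>r x y. r \<ge> 1 \<Longrightarrow> \<bar>x - y\<bar> \<le> 1 \<Longrightarrow>
    \<bar>target r y - target r x\<bar> \<le> C * \<bar>x - y\<bar> * exp (- x\<^sup>2 / 2)"
proof -
  obtain C where C: "C > 0" "\<And>x. (1 + x\<^sup>2) ^ 5 * quartic x \<le> C * exp (- x\<^sup>2)"
    using quartic_poly_dominated[of 5] by metis
  show ?thesis
  proof
    show "3 * C * exp 1 > 0" using C by simp
    fix r x y :: real assume r: "r \<ge> 1" and xy: "\<bar>x - y\<bar> \<le> 1"
    define D where "D z = quartic z * (- (z ^ 3) / 3 * (1 + corr z / r\<^sup>2) + (z - z ^ 5 / 5) / r\<^sup>2)" for z
    have D: "(target r has_real_derivative D z) (at z)" for z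
      unfolding target_def quartic_def corr_def D_def using r
      by (auto intro!: derivative_eq_intros simp: field_simps)
    have "r\<^sup>2 \<ge> 1" using r by simp
    have Dle: "\<bar>D z\<bar> \<le> 3 * C * exp (- z\<^sup>2)" for z
    proof -
      define Q where "Q = (1 + z\<^sup>2) ^ 5"
      have "\<bar>corr z / r\<^sup>2\<bar> \<le> \<bar>corr z\<bar> / 1" unfolding abs_divide
        using \<open>r\<^sup>2 \<ge> 1\<close> by (intro frac_le) auto
    moreover have "1 \<le> (1 + z\<^sup>2) ^ 3" by (intro one_le_power) auto
    ultimately have t: "\<bar>1 + corr z / r\<^sup>2\<bar> \<le> 2 * (1 + z\<^sup>2) ^ 3" using abs_corr_le[of z] by linarith
      have "\<bar>- (z ^ 3) / 3 * (1 + corr z / r\<^sup>2)\<bar> = \<bar>z\<bar> ^ 3 / 3 * \<bar>1 + corr z / r\<^sup>2\<bar>"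
        by (simp add: abs_mult power_abs)
      also have "\<dots> \<le> (1 + z\<^sup>2) ^ 2 / 3 * (2 * (1 + z\<^sup>2) ^ 3)"
        using t by (intro mult_mono divide_right_mono power_le_one_plus_square_power) auto
      also have "\<dots> = 2 / 3 * Q" by (simp add: Q_def power_add[symmetric])
      finally have 1: "\<bar>- (z ^ 3) / 3 * (1 + corr z / r\<^sup>2)\<bar> \<le> 2 / 3 * Q" .
      have "\<bar>(z - z ^ 5 / 5) / r\<^sup>2\<bar> \<le> \<bar>z - z ^ 5 / 5\<bar> / 1" unfolding abs_divide
        using \<open>r\<^sup>2 \<ge> 1\<close> by (intro frac_le) auto
      also have "\<dots> \<le> \<bar>z\<bar> ^ 1 + \<bar>z\<bar> ^ 5 / 5"
        using abs_triangle_ineq4[of z "z ^ 5 / 5"] by (simp add: power_abs)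
      also have "\<dots> \<le> Q + Q / 5"
        unfolding Q_def by (intro add_mono divide_right_mono power_le_one_plus_square_power) auto
      finally have 2: "\<bar>(z - z ^ 5 / 5) / r\<^sup>2\<bar> \<le> Q + Q / 5" .
      have "0 \<le> Q" by (simp add: Q_def)
      have "\<bar>- (z ^ 3) / 3 * (1 + corr z / r\<^sup>2) + (z - z ^ 5 / 5) / r\<^sup>2\<bar> \<le> 2 / 3 * Q + (Q + Q / 5)"
        by (rule order_trans[OF abs_triangle_ineq add_mono[OF 1 2]])
      also have "\<dots> \<le> 3 * Q" using \<open>0 \<le> Q\<close> by simp
      finally have "\<bar>- (z ^ 3) / 3 * (1 + corr z / r\<^sup>2) + (z - z ^ 5 / 5) / r\<^sup>2\<bar> \<le> 3 * Q" .
      then have "\<bar>D z\<bar> \<le> quartic z * (3 * Q)"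
        unfolding D_def abs_mult using quartic_pos[of z] \<open>0 \<le> Q\<close> by (intro mult_mono) auto
      also have "\<dots> = 3 * (Q * quartic z)" by simp
      also have "\<dots> \<le> 3 * (C * exp (- z\<^sup>2))" unfolding Q_def by (intro mult_left_mono C) simp
      finally show ?thesis by simp
    qed
    have "norm (target r y - target r x) \<le> (3 * C * exp 1 * exp (- x\<^sup>2 / 2)) * norm (y - x)"
    proof (rule field_differentiable_bound)
      show "convex (closed_segment x y)" by simp
      fix z assume z: "z \<in> closed_segment x y"
      show "(target r has_field_derivative D z) (at z within closed_segment x y)"
        using D by (rule has_field_derivative_at_within)
      have "\<bar>x - z\<bar> \<le> 1" using z xy by (auto simp: closed_segment_eq_real_ivl split: if_splits)
      then have "3 * C * exp (- z\<^sup>2) \<le> 3 * C * (exp 1 * exp (- x\<^sup>2 / 2))"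
        using C by (intro mult_left_mono exp_minus_square_shift) auto
      then show "norm (D z) \<le> 3 * C * exp 1 * exp (- x\<^sup>2 / 2)" using Dle[of z] by simp
    qed auto
    then show "\<bar>target r y - target r x\<bar> \<le> 3 * C * exp 1 * \<bar>x - y\<bar> * exp (- x\<^sup>2 / 2)"
      by (simp add: mult_ac abs_minus_commute)
  qed
qed

text \<open>Here \<open>r = n\<^bsup>1/4\<^esup>\<close>, and \<open>b\<close> is an unnormalised density of \<open>W\<^sub>n\<close> plus an independent uniform variable on
  \<open>[- n\<^bsup>-3/4\<^esup>, n\<^bsup>-3/4\<^esup>)\<close>; these intervals around the atoms of \<open>W\<^sub>n\<close> tile the line.\<close>

lemma spread_density:
  obtains C where "C > 0" "\<And>n r. n \<ge> 1 \<Longrightarrow> r > 0 \<Longrightarrow> r ^ 4 = real n \<Longrightarrow>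
    \<exists>b. b \<in> borel_measurable borel \<and> (\<forall>x. \<bar>b x - target r x\<bar> \<le> C / r ^ 3 * exp (- x\<^sup>2 / 2)) \<and>
      (LINT x|lborel. b x) > 0 \<and>
      (\<forall>h. 1-lipschitz_on UNIV h \<longrightarrow>
        \<bar>(LINT x|lborel. b x * h x) - (LINT x|lborel. b x) *
          ((\<Sum>k\<le>n. spin_weight n k * h ((2 * real k - real n) / r ^ 3)) / (\<Sum>k\<le>n. spin_weight n k))\<bar>
        \<le> (LINT x|lborel. b x) / r ^ 3)"
proof -
  obtain C1 where C1: "C1 > 0" "\<And>n r. n \<ge> 1 \<Longrightarrow> r > 0 \<Longrightarrow> r ^ 4 = real n \<Longrightarrow>
    \<exists>A>0. \<forall>k\<le>n. \<forall>x. x * r ^ 3 = 2 * real k - real n \<longrightarrow>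
      \<bar>spin_weight n k / A - quartic x * (1 + corr x / r\<^sup>2)\<bar> \<le> C1 * exp (- x\<^sup>2) / r ^ 4"
    using spin_weight_local_limit by blast
  obtain C2 where C2: "C2 > 0" "\<And>r x. r \<ge> 1 \<Longrightarrow> \<bar>x\<bar> \<ge> r \<Longrightarrow> \<bar>target r x\<bar> \<le> C2 * exp (- x\<^sup>2) / r ^ 3"
    using target_tail by blast
  obtain C3 where C3: "C3 > 0" "\<And>r x y. r \<ge> 1 \<Longrightarrow> \<bar>x - y\<bar> \<le> 1 \<Longrightarrow>
    \<bar>target r y - target r x\<bar> \<le> C3 * \<bar>x - y\<bar> * exp (- x\<^sup>2 / 2)"
    using target_local_lipschitz by blast
  show ?thesis
  proof
    \<comment> \<open>Three sources of error: the local limit theorem at the atom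
      (\<open>C1\<close>, with \<open>exp 1\<close> from moving the Gaussian to \<open>x\<close>),
      the region beyond the cells (\<open>C2\<close>), and the variation of \<open>target\<close>
      inside a cell (\<open>C3\<close>).\<close>
    show "C1 * exp 1 + C2 + C3 > 0" using C1(1) C2(1) C3(1) by (simp add: add_pos_pos)
    fix n :: nat and r :: real
    assume n: "n \<ge> 1" and r0: "r > 0" and rn: "r ^ 4 = real n"
    have r1: "r \<ge> 1" using n r0 rn by (rule root4_ge_one)
    have r3: "r ^ 3 > 0" using r0 by simp
    have r31: "r ^ 3 \<ge> 1" using r1 by (rule one_le_power)
    obtain A where A: "A > 0" "\<And>k x. k \<le> n \<Longrightarrow> x * r ^ 3 = 2 * real k - real n \<Longrightarrow>
      \<bar>spin_weight n k / A - target r x\<bar> \<le> C1 * exp (- x\<^sup>2) / r ^ 4"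
      using C1(2)[OF n r0 rn] unfolding target_def by metis
    define pt where "pt k = (2 * real k - real n) / r ^ 3" for k
    define cell where "cell k = {pt k - 1 / r ^ 3 ..< pt k + 1 / r ^ 3}" for k
    \<comment> \<open>After scaling, cell \<open>k\<close> is the interval from \<open>2 * k\<close>
      to \<open>2 * k + 2\<close>, closed on the left only, so the cells are disjoint and leave no
      gaps.\<close>
    have cell_iff: "x \<in> cell k \<longleftrightarrow> 2 * real k \<le> x * r ^ 3 + real n + 1 \<and> x * r ^ 3 + real n + 1 < 2 * real k + 2" for x k
    proof -
      have "pt k - 1 / r ^ 3 = (2 * real k - real n - 1) / r ^ 3" "pt k + 1 / r ^ 3 = (2 * real k - real n + 1) / r ^ 3"
        by (simp_all add: pt_def diff_divide_distrib add_divide_distrib)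
      then show ?thesis
        using r3 by (simp add: cell_def pos_divide_le_eq pos_less_divide_eq) linarith
    qed
    define b where "b x = (\<Sum>k\<le>n. spin_weight n k / A * indicator (cell k) x)" for x
    have cellM [measurable]: "cell k \<in> sets borel" for k by (simp add: cell_def)
    have bM [measurable]: "b \<in> borel_measurable borel" unfolding b_def by measurable
    have close: "\<bar>b x - target r x\<bar> \<le> (C1 * exp 1 + C2 + C3) / r ^ 3 * exp (- x\<^sup>2 / 2)" for x
    proof -
      have Cle: "K / r ^ 3 * exp (- x\<^sup>2 / 2) \<le> (C1 * exp 1 + C2 + C3) / r ^ 3 * exp (- x\<^sup>2 / 2)"
        if "K \<le> C1 * exp 1 + C2 + C3" for K
        using that r3 by (intro mult_right_mono divide_right_mono) auto
      show ?thesis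
      proof (cases "\<exists>k\<le>n. x \<in> cell k")
        case True
        then obtain k where k: "k \<le> n" "x \<in> cell k" by blast
        have ind: "indicator (cell j) x = (if j = k then 1 else 0 :: real)" for j
          using k(2) unfolding indicator_def cell_iff by auto
        have bx: "b x = spin_weight n k / A"
          unfolding b_def ind using k(1) by (simp add: if_distrib cong: if_cong)
        have dist: "\<bar>x - pt k\<bar> \<le> 1 / r ^ 3" using k(2) by (auto simp: cell_def)
        have "1 / r ^ 3 \<le> 1" using frac_le[of 1 1 1 "r ^ 3"] r31 by simp
        then have dist1: "\<bar>x - pt k\<bar> \<le> 1" using dist by linarith
        have "\<bar>b x - target r (pt k)\<bar> \<le> C1 * exp (- (pt k)\<^sup>2) / r ^ 4"
          unfolding bx using k(1) r3 by (intro A) (auto simp: pt_def)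
        also have "\<dots> \<le> C1 * (exp 1 * exp (- x\<^sup>2 / 2)) / r ^ 3"
          using C1(1) dist1 r1 r3 by (intro frac_le mult_left_mono exp_minus_square_shift power_increasing) auto
        finally have "\<bar>b x - target r (pt k)\<bar> \<le> C1 * exp 1 / r ^ 3 * exp (- x\<^sup>2 / 2)" by simp
        moreover have "\<bar>target r (pt k) - target r x\<bar> \<le> C3 * \<bar>x - pt k\<bar> * exp (- x\<^sup>2 / 2)"
          using r1 dist1 by (rule C3)
        moreover have "C3 * \<bar>x - pt k\<bar> * exp (- x\<^sup>2 / 2) \<le> C3 * (1 / r ^ 3) * exp (- x\<^sup>2 / 2)"
          using C3(1) dist by (intro mult_right_mono mult_left_mono) auto
        ultimately have "\<bar>b x - target r x\<bar> \<le> C1 * exp 1 / r ^ 3 * exp (- x\<^sup>2 / 2) + C3 * (1 / r ^ 3) * exp (- x\<^sup>2 / 2)"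
          by linarith
        also have "\<dots> = (C1 * exp 1 + C3) / r ^ 3 * exp (- x\<^sup>2 / 2)"
          by (simp add: add_divide_distrib distrib_right)
        finally show ?thesis using Cle[of "C1 * exp 1 + C3"] C2(1) by linarith
      next
        case False
        then have bx: "b x = 0" by (auto simp: b_def indicator_def)
        have "\<bar>x * r ^ 3\<bar> \<ge> real n"
        proof (rule ccontr)
          define y where "y = x * r ^ 3"
          assume "\<not> \<bar>x * r ^ 3\<bar> \<ge> real n"
          then have y: "- real n < y" "y < real n" by (auto simp: y_def abs_less_iff not_le)
          \<comment> \<open>The only index whose cell can contain \<open>x\<close>;
            \<open>y < n\<close> forces \<open>k \<le> n\<close>.\<close>
          define k where "k = nat \<lfloor>(y + real n + 1) / 2\<rfloor>"
          have "(y + real n + 1) / 2 \<ge> 0" using y by simp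
          then have "real k = of_int \<lfloor>(y + real n + 1) / 2\<rfloor>" by (simp add: k_def)
          then have "real k \<le> (y + real n + 1) / 2" "(y + real n + 1) / 2 < real k + 1"
            by linarith+
          then have "x \<in> cell k" "real k < real n + 1"
            unfolding cell_iff y_def[symmetric] using y by auto
          then show False using False by auto
        qed
        then have "r ^ 3 * r \<le> r ^ 3 * \<bar>x\<bar>" unfolding rn[symmetric] using r0
          by (simp add: abs_mult mult.commute eval_nat_numeral)
        then have "\<bar>x\<bar> \<ge> r" using r3 by simp
        then have "\<bar>b x - target r x\<bar> \<le> C2 * exp (- x\<^sup>2) / r ^ 3" using C2(2)[OF r1] bx by simp
        also have "\<dots> \<le> C2 * exp (- x\<^sup>2 / 2) / r ^ 3"
          using C2(1) r3 by (intro divide_right_mono mult_left_mono) auto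
        finally show ?thesis using Cle[of C2] C1(1) C3(1) by simp
      qed
    qed
    have emc: "emeasure lborel (cell k) < \<infinity>" for k using r3 by (simp add: cell_def)
    have mc: "measure lborel (cell k) = 2 / r ^ 3" for k using r3 by (simp add: cell_def)
    define S where "S = (\<Sum>k\<le>n. spin_weight n k)"
    have S: "S > 0" unfolding S_def by (intro sum_pos) (auto intro: spin_weight_pos)
    have intb: "(LINT x|lborel. b x) = 2 / r ^ 3 * S / A"
      unfolding b_def using emc by (simp add: mc S_def sum_distrib_left sum_divide_distrib mult_ac)
    then have Bpos: "(LINT x|lborel. b x) > 0" using S A(1) r3 by simp
    have lip: "\<bar>(LINT x|lborel. b x * h x) - (LINT x|lborel. b x) * ((\<Sum>k\<le>n. spin_weight n k * h (pt k)) / S)\<bar>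
        \<le> (LINT x|lborel. b x) / r ^ 3" if h: "1-lipschitz_on UNIV h" for h
    proof -
      have hM: "h \<in> borel_measurable borel"
        using lipschitz_on_continuous_on[OF h] by (rule borel_measurable_continuous_onI)
      have hl: "\<bar>h x - h y\<bar> \<le> \<bar>x - y\<bar>" for x y
        using lipschitz_onD[OF h, of x y] by (simp add: dist_real_def)
      have near: "\<bar>indicator (cell k) x * (h x - h (pt k))\<bar> \<le> indicator (cell k) x * (1 / r ^ 3)" for k x
      proof (cases "x \<in> cell k")
        case True
        then have "\<bar>x - pt k\<bar> \<le> 1 / r ^ 3" by (auto simp: cell_def)
        then show ?thesis using hl[of x "pt k"] True by simp
      qed simp
      have ind: "integrable lborel (\<lambda>x. indicator (cell k) x * (a::real))" for k a
        using emc by (intro integrable_mult_left integrable_real_indicator) auto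
      have id: "integrable lborel (\<lambda>x. indicator (cell k) x * (h x - h (pt k)))" for k
      proof (rule Bochner_Integration.integrable_bound[OF ind[of k "1 / r ^ 3"]])
        show "AE x in lborel. norm (indicator (cell k) x * (h x - h (pt k))) \<le> norm (indicator (cell k) x * (1 / r ^ 3))"
          using near r3 by (intro AE_I2) (auto simp: abs_mult)
      qed (use hM in measurable)
      have ic: "integrable lborel (\<lambda>x. indicator (cell k) x * h x)" for k
        using Bochner_Integration.integrable_add[OF id[of k] ind[of k "h (pt k)"]] by (simp add: algebra_simps)
      have cellint: "\<bar>(LINT x|lborel. indicator (cell k) x * h x) - 2 / r ^ 3 * h (pt k)\<bar> \<le> 2 / r ^ 3 * (1 / r ^ 3)" for k
      proof -
        have 1: "(LINT x|lborel. indicator (cell k) x * h x) - (LINT x|lborel. indicator (cell k) x * h (pt k))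
          = (LINT x|lborel. indicator (cell k) x * (h x - h (pt k)))"
          using Bochner_Integration.integral_diff[OF ic[of k] ind[of k "h (pt k)"]] by (simp add: right_diff_distrib)
        have "\<bar>LINT x|lborel. indicator (cell k) x * (h x - h (pt k))\<bar>
          \<le> (LINT x|lborel. \<bar>indicator (cell k) x * (h x - h (pt k))\<bar>)" by (rule integral_abs_bound)
        also have "\<dots> \<le> (LINT x|lborel. indicator (cell k) x * (1 / r ^ 3))"
          using id ind near by (intro integral_mono) auto
        finally have 2: "\<bar>LINT x|lborel. indicator (cell k) x * (h x - h (pt k))\<bar> \<le> (LINT x|lborel. indicator (cell k) x * (1 / r ^ 3))" .
        have ci: "(LINT x|lborel. indicator (cell k) x * (a::real)) = 2 / r ^ 3 * a" for a
          by (simp add: mc)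
        show ?thesis using 1 2 unfolding ci by linarith
      qed
      have "(LINT x|lborel. b x * h x) = (\<Sum>k\<le>n. spin_weight n k / A * (LINT x|lborel. indicator (cell k) x * h x))"
        unfolding b_def sum_distrib_right mult.assoc
        using ic by (subst Bochner_Integration.integral_sum) auto
      moreover have "(LINT x|lborel. b x) * ((\<Sum>k\<le>n. spin_weight n k * h (pt k)) / S)
        = (\<Sum>k\<le>n. spin_weight n k / A * (2 / r ^ 3 * h (pt k)))"
        unfolding intb using S by (simp add: sum_distrib_left sum_divide_distrib mult_ac)
      ultimately have "\<bar>(LINT x|lborel. b x * h x) - (LINT x|lborel. b x) * ((\<Sum>k\<le>n. spin_weight n k * h (pt k)) / S)\<bar>
        = \<bar>\<Sum>k\<le>n. spin_weight n k / A * ((LINT x|lborel. indicator (cell k) x * h x) - 2 / r ^ 3 * h (pt k))\<bar>"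
        by (simp only: sum_subtractf right_diff_distrib)
      also have "\<dots> \<le> (\<Sum>k\<le>n. spin_weight n k / A * (2 / r ^ 3 * (1 / r ^ 3)))"
      proof (rule order_trans[OF sum_abs], rule sum_mono)
        fix k assume "k \<in> {..n}"
        then have "spin_weight n k / A > 0" using A(1) spin_weight_pos by simp
        then show "\<bar>spin_weight n k / A * ((LINT x|lborel. indicator (cell k) x * h x) - 2 / r ^ 3 * h (pt k))\<bar>
          \<le> spin_weight n k / A * (2 / r ^ 3 * (1 / r ^ 3))"
          unfolding abs_mult using cellint[of k] by (intro mult_mono) auto
      qed
      also have "\<dots> = (LINT x|lborel. b x) / r ^ 3"
        unfolding intb S_def by (simp add: sum_distrib_left sum_divide_distrib mult_ac)
      finally show ?thesis .
    qed
    show "\<exists>b. b \<in> borel_measurable borel \<and> (\<forall>x. \<bar>b x - target r x\<bar> \<le> (C1 * exp 1 + C2 + C3) / r ^ 3 * exp (- x\<^sup>2 / 2)) \<and>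
      (LINT x|lborel. b x) > 0 \<and>
      (\<forall>h. 1-lipschitz_on UNIV h \<longrightarrow>
        \<bar>(LINT x|lborel. b x * h x) - (LINT x|lborel. b x) *
          ((\<Sum>k\<le>n. spin_weight n k * h ((2 * real k - real n) / r ^ 3)) / (\<Sum>k\<le>n. spin_weight n k))\<bar>
        \<le> (LINT x|lborel. b x) / r ^ 3)"
      using bM close Bpos lip unfolding pt_def S_def by (intro exI[of _ b]) blast
  qed
qed

section \<open>Normalisation and comparison of expectations\<close>

theorem theorem4p4:
  shows "\<exists>C::real. \<forall>n\<ge>(1::nat). \<forall>h::real \<Rightarrow> real. lipschitz_on 1 UNIV h \<longrightarrow>
    \<bar>(LINT \<sigma>|curie_weiss n. h (W n \<sigma>)) - (LINT z|Z4_law. h z)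
       - 1 / sqrt (real n) * (LINT z|Z4_law. e1 z * h z)\<bar>
    \<le> C * real n powr (- 3 / 4)"
proof -
  define c where "c = (LINT x|lborel. quartic x)"
  define \<kappa> where "\<kappa> = (LINT z|Z4_law. z\<^sup>2) / 5"
  define m0 where "m0 = (LINT x::real|lborel. \<bar>x\<bar> ^ 0 * exp (- x\<^sup>2 / 2))"
  define m1 where "m1 = (LINT x::real|lborel. \<bar>x\<bar> ^ 1 * exp (- x\<^sup>2 / 2))"
  \<comment> \<open>The signed density behind the two terms with \<open>Z\<^sub>4\<close>. Its
    integral is 1, since \<open>quartic\<close> times \<open>corr x - \<kappa>\<close> integrates to
    zero.\<close>
  define q where "q r x = quartic x / c * (1 + (corr x - \<kappa>) / r\<^sup>2)" for r x
  have c: "c > 0" unfolding c_def by (rule quartic_integral_pos)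
  have m: "m0 \<ge> 0" "m1 \<ge> 0" unfolding m0_def m1_def by (auto intro!: integral_nonneg_AE)
  have \<kappa>: "\<kappa> \<ge> 0" unfolding \<kappa>_def by (auto intro!: integral_nonneg_AE)
  have int_quartic: "integrable lborel quartic" using integrable_quartic_power[of 0] by simp
  have corr_alt: "quartic x * corr x = (1 / 2) * (quartic x * x\<^sup>2) - (1 / 30) * (quartic x * x ^ 6)" for x
    by (simp add: corr_def algebra_simps)
  have int_corr: "integrable lborel (\<lambda>x. quartic x * corr x)"
    unfolding corr_alt by (intro Bochner_Integration.integrable_diff integrable_mult_right integrable_quartic_power)
  have I_corr: "(LINT x|lborel. quartic x * corr x) = c * \<kappa>"
  proof -
    have "(LINT x|lborel. quartic x * corr x)
        = (1 / 2) * (LINT x|lborel. quartic x * x\<^sup>2) - (1 / 30) * (LINT x|lborel. quartic x * x ^ 6)"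
      unfolding corr_alt
      by (subst Bochner_Integration.integral_diff) (auto intro!: integrable_quartic_power)
    \<comment> \<open>The factor 1/5 in \<open>e1\<close> is \<open>1 / 2 - 9 / 30\<close>.\<close>
    also have "\<dots> = (LINT x|lborel. quartic x * x\<^sup>2) / 5"
      unfolding quartic_moment_recursion by simp
    also have "\<dots> = c * \<kappa>"
      using c unfolding \<kappa>_def by (simp add: integral_Z4_law c_def[symmetric])
    finally show ?thesis .
  qed
  have e1: "e1 x = corr x - \<kappa>" for x by (simp add: e1_def corr_def \<kappa>_def)

  obtain Q where Q: "Q > 0" "\<And>x. (1 + x\<^sup>2) ^ 3 * quartic x \<le> Q * exp (- x\<^sup>2)"
    using quartic_poly_dominated[of 3] by metis
  have Qk: "quartic x * \<bar>corr x - \<kappa>\<bar> \<le> (1 + \<kappa>) * Q * exp (- x\<^sup>2 / 2)"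
    and Q1: "quartic x \<le> Q * exp (- x\<^sup>2 / 2)"
    and Qc: "quartic x * \<bar>corr x\<bar> \<le> Q * exp (- x\<^sup>2 / 2)" for x
  proof -
    have one: "1 \<le> (1 + x\<^sup>2) ^ 3" by (intro one_le_power) auto
    then have "\<kappa> * 1 \<le> \<kappa> * (1 + x\<^sup>2) ^ 3" using \<kappa> by (intro mult_left_mono) auto
    then have "\<bar>corr x - \<kappa>\<bar> \<le> (1 + \<kappa>) * (1 + x\<^sup>2) ^ 3"
      unfolding distrib_right using abs_corr_le[of x] \<kappa> abs_triangle_ineq4[of "corr x" \<kappa>] by simp
    then have "quartic x * \<bar>corr x - \<kappa>\<bar> \<le> quartic x * ((1 + \<kappa>) * (1 + x\<^sup>2) ^ 3)"
      using quartic_pos[of x] by (intro mult_left_mono) auto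
    also have "\<dots> = (1 + \<kappa>) * ((1 + x\<^sup>2) ^ 3 * quartic x)" by simp
    also have ex: "(1 + x\<^sup>2) ^ 3 * quartic x \<le> Q * exp (- x\<^sup>2 / 2)"
      using Q(1) by (intro order_trans[OF Q(2)]) simp
    finally show "quartic x * \<bar>corr x - \<kappa>\<bar> \<le> (1 + \<kappa>) * Q * exp (- x\<^sup>2 / 2)" using \<kappa> by simp
    have "1 * quartic x \<le> (1 + x\<^sup>2) ^ 3 * quartic x"
      using one quartic_pos[of x] by (intro mult_right_mono) auto
    then show "quartic x \<le> Q * exp (- x\<^sup>2 / 2)" using ex by simp
    have "quartic x * \<bar>corr x\<bar> \<le> quartic x * (1 + x\<^sup>2) ^ 3"
      using quartic_pos[of x] abs_corr_le by (intro mult_left_mono) auto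
    also have "\<dots> \<le> Q * exp (- x\<^sup>2 / 2)" using ex by (simp add: mult.commute)
    finally show "quartic x * \<bar>corr x\<bar> \<le> Q * exp (- x\<^sup>2 / 2)" .
  qed
  define Kq where "Kq = (2 + \<kappa>) * Q / c"
  have Kq: "Kq > 0" using Q(1) \<kappa> c by (simp add: Kq_def)
  have q_le: "\<bar>q r x\<bar> \<le> Kq * exp (- x\<^sup>2 / 2)" if "r \<ge> 1" for r x
  proof -
    have "r\<^sup>2 \<ge> 1" using that by simp
    then have "\<bar>(corr x - \<kappa>) / r\<^sup>2\<bar> \<le> \<bar>corr x - \<kappa>\<bar> / 1" unfolding abs_divide
      by (intro frac_le) auto
    then have "\<bar>1\<bar> + \<bar>(corr x - \<kappa>) / r\<^sup>2\<bar> \<le> 1 + \<bar>corr x - \<kappa>\<bar>" by simp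
    with abs_triangle_ineq have "\<bar>1 + (corr x - \<kappa>) / r\<^sup>2\<bar> \<le> 1 + \<bar>corr x - \<kappa>\<bar>" by (rule order_trans)
    then have "\<bar>q r x\<bar> \<le> quartic x / c * (1 + \<bar>corr x - \<kappa>\<bar>)"
      unfolding q_def abs_mult using quartic_pos[of x] c by (intro mult_mono) auto
    also have "\<dots> = (quartic x + quartic x * \<bar>corr x - \<kappa>\<bar>) / c" by (simp add: distrib_left add_divide_distrib)
    also have "\<dots> \<le> (Q * exp (- x\<^sup>2 / 2) + (1 + \<kappa>) * Q * exp (- x\<^sup>2 / 2)) / c"
      using c by (intro divide_right_mono add_mono Qk Q1) auto
    also have "\<dots> = Kq * exp (- x\<^sup>2 / 2)" by (simp add: Kq_def algebra_simps)
    finally show ?thesis .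
  qed
  have q_measurable [measurable]: "q r \<in> borel_measurable borel" for r unfolding q_def by measurable
  obtain C where C: "C > 0" "\<And>n r. n \<ge> 1 \<Longrightarrow> r > 0 \<Longrightarrow> r ^ 4 = real n \<Longrightarrow>
    \<exists>b. b \<in> borel_measurable borel \<and> (\<forall>x. \<bar>b x - target r x\<bar> \<le> C / r ^ 3 * exp (- x\<^sup>2 / 2)) \<and>
      (LINT x|lborel. b x) > 0 \<and>
      (\<forall>h. 1-lipschitz_on UNIV h \<longrightarrow>
        \<bar>(LINT x|lborel. b x * h x) - (LINT x|lborel. b x) *
          ((\<Sum>k\<le>n. spin_weight n k * h ((2 * real k - real n) / r ^ 3)) / (\<Sum>k\<le>n. spin_weight n k))\<bar>
        \<le> (LINT x|lborel. b x) / r ^ 3)"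
    using spread_density by blast
  \<comment> \<open>The summands of \<open>K\<close> account for \<open>b - target r\<close>, for
    \<open>target r - F * q r\<close>, and for \<open>(F - B) * q r\<close>.\<close>
  define K where "K = C + \<kappa> * (1 + \<kappa>) * Q + C * m0 * Kq"
  have K: "K > 0" using C(1) \<kappa> Q(1) m Kq by (simp add: K_def add_pos_nonneg)
  define R where "R = 2 * C * m0 / c"
  have R: "R \<ge> 0" using C(1) m c by (simp add: R_def)
  \<comment> \<open>The first bracket serves those \<open>n\<close> for which the mass
    \<open>B\<close> is surely at least \<open>c / 2\<close>; the other summand serves the remaining
    \<open>n\<close>, where \<open>r ^ 3 \<le> R\<close>.\<close>
  define D where "D = (1 + 2 * K * m1 / c) + (R + Kq * m1) * R"
  show ?thesis
  proof (intro exI[of _ D] allI impI)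
    fix n :: nat and h :: "real \<Rightarrow> real"
    assume n: "n \<ge> 1" and lip: "1-lipschitz_on UNIV h"
    define r where "r = real n powr (1 / 4)"
    have r0: "r > 0" using n by (simp add: r_def)
    have r1: "r \<ge> 1" using n by (simp add: r_def ge_one_powr_ge_zero)
    have rn: "r ^ 4 = real n" using n by (simp add: r_def powr_power)
    have r3: "r ^ 3 > 0" "r ^ 3 \<ge> 1" using r0 r1 by auto
    have powr: "real n powr (- 3 / 4) = 1 / r ^ 3"
      using n by (simp add: r_def powr_power powr_minus_divide)
    have sqrt: "sqrt (real n) = r\<^sup>2"
      using r0 by (simp add: rn[symmetric] real_sqrt_unique power_mult[symmetric])
    define E where "E = (\<Sum>k\<le>n. spin_weight n k * (h ((2 * real k - real n) / r ^ 3) - h 0)) / (\<Sum>k\<le>n. spin_weight n k)"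
    have S: "(\<Sum>k\<le>n. spin_weight n k) > 0" by (intro sum_pos) (auto intro: spin_weight_pos)
    define g where "g x = h x - h 0" for x
    have lipg: "1-lipschitz_on UNIV g"
      using lip by (simp add: lipschitz_on_def g_def dist_real_def)
    have g_le: "\<bar>g x\<bar> \<le> \<bar>x\<bar>" for x
      using lipschitz_onD[OF lip, of x 0] by (simp add: dist_real_def g_def)
    have [measurable]: "g \<in> borel_measurable borel" "h \<in> borel_measurable borel"
      using lipschitz_on_continuous_on[OF lipg] lipschitz_on_continuous_on[OF lip]
      by (auto intro: borel_measurable_continuous_onI)
    have [measurable]: "e1 \<in> borel_measurable borel" unfolding e1[abs_def] by measurable
    have E1: "(LINT \<sigma>|curie_weiss n. h (W n \<sigma>)) = h 0 + E"
    proof -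
      have "E = (\<Sum>k\<le>n. spin_weight n k * h ((2 * real k - real n) / r ^ 3)) / (\<Sum>k\<le>n. spin_weight n k) - h 0"
        unfolding E_def using S
        by (simp add: right_diff_distrib sum_subtractf sum_distrib_right[symmetric] diff_divide_distrib)
      then show ?thesis unfolding integral_curie_weiss powr by simp
    qed
    have int_g: "integrable lborel (\<lambda>x. quartic x * g x)" "integrable lborel (\<lambda>x. quartic x * corr x * g x)"
    proof -
      have "\<bar>quartic x * g x\<bar> \<le> Q * (\<bar>x\<bar> ^ 1 * exp (- x\<^sup>2 / 2))" for x
        using mult_mono[OF Q1[of x] g_le[of x]] Q(1) quartic_pos[of x] by (simp add: abs_mult mult_ac)
      then show "integrable lborel (\<lambda>x. quartic x * g x)" by (rule integrable_gaussian_dominated[rotated]) simp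
      have "\<bar>quartic x * corr x * g x\<bar> \<le> Q * (\<bar>x\<bar> ^ 1 * exp (- x\<^sup>2 / 2))" for x
        using mult_mono[OF Qc[of x] g_le[of x]] Q(1) quartic_pos[of x] by (simp add: abs_mult mult_ac)
      then show "integrable lborel (\<lambda>x. quartic x * corr x * g x)" by (rule integrable_gaussian_dominated[rotated]) simp
    qed
    have E2: "(LINT z|Z4_law. h z) + 1 / sqrt (real n) * (LINT z|Z4_law. e1 z * h z) = h 0 + (LINT x|lborel. q r x * g x)"
    proof -
      have "(LINT z|Z4_law. h z) = ((LINT x|lborel. quartic x * h 0 + quartic x * g x)) / c"
        by (subst integral_Z4_law) (simp_all add: c_def g_def algebra_simps)
      also have "\<dots> = h 0 + (LINT x|lborel. quartic x * g x) / c"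
        using c int_g int_quartic
        by (subst Bochner_Integration.integral_add) (auto simp: c_def[symmetric] add_divide_distrib)
      finally have 1: "(LINT z|Z4_law. h z) = h 0 + (LINT x|lborel. quartic x * g x) / c" .
      \<comment> \<open>The contribution of \<open>h 0\<close> is isolated and vanishes by
        \<open>I_corr\<close>.\<close>
      have "(LINT z|Z4_law. e1 z * h z) = (LINT x|lborel. ((quartic x * corr x) * h 0 - quartic x * (\<kappa> * h 0))
          + (quartic x * corr x * g x - \<kappa> * (quartic x * g x))) / c"
        by (subst integral_Z4_law) (simp_all add: c_def g_def e1 algebra_simps)
      also have "(LINT x|lborel. ((quartic x * corr x) * h 0 - quartic x * (\<kappa> * h 0))
          + (quartic x * corr x * g x - \<kappa> * (quartic x * g x)))
          = (c * \<kappa> * h 0 - c * (\<kappa> * h 0)) + ((LINT x|lborel. quartic x * corr x * g x) - \<kappa> * (LINT x|lborel. quartic x * g x))"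
        using int_g int_quartic int_corr
        by (simp add: Bochner_Integration.integral_add Bochner_Integration.integral_diff I_corr c_def[symmetric])
      finally have 2: "(LINT z|Z4_law. e1 z * h z)
          = ((LINT x|lborel. quartic x * corr x * g x) - \<kappa> * (LINT x|lborel. quartic x * g x)) / c" by simp
      have "(LINT x|lborel. q r x * g x) = (LINT x|lborel. (1 / c) * (quartic x * g x)
          + 1 / r\<^sup>2 * ((1 / c) * (quartic x * corr x * g x - \<kappa> * (quartic x * g x))))"
        using r0 c by (intro Bochner_Integration.integral_cong) (auto simp: q_def field_simps)
      also have "\<dots> = (1 / c) * (LINT x|lborel. quartic x * g x)
          + 1 / r\<^sup>2 * ((1 / c) * ((LINT x|lborel. quartic x * corr x * g x) - \<kappa> * (LINT x|lborel. quartic x * g x)))"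
        using int_g by (simp add: Bochner_Integration.integral_add Bochner_Integration.integral_diff)
      finally show ?thesis unfolding 1 2 sqrt by simp
    qed
    have qg: "\<bar>LINT x|lborel. q r x * g x\<bar> \<le> Kq * m1"
      unfolding m1_def
    proof (rule integral_gaussian_dominated)
      show "\<bar>q r x * g x\<bar> \<le> Kq * (\<bar>x\<bar> ^ 1 * exp (- x\<^sup>2 / 2))" for x
        using mult_mono[OF q_le[OF r1, of x] g_le[of x]] Kq by (simp add: abs_mult mult_ac)
    qed simp
    obtain b where [measurable]: "b \<in> borel_measurable borel"
      and b: "\<And>x. \<bar>b x - target r x\<bar> \<le> C / r ^ 3 * exp (- x\<^sup>2 / 2)"
      and Bpos: "(LINT x|lborel. b x) > 0"
      and bg: "\<bar>(LINT x|lborel. b x * g x) - (LINT x|lborel. b x) * E\<bar> \<le> (LINT x|lborel. b x) / r ^ 3"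
      using C(2)[OF n r0 rn] lipg unfolding E_def g_def by blast
    define B where "B = (LINT x|lborel. b x)"
    have target_split: "target r x = quartic x + 1 / r\<^sup>2 * (quartic x * corr x)" for x
      by (simp add: target_def algebra_simps)
    have int_target: "integrable lborel (target r)"
      unfolding target_split[abs_def] using int_quartic int_corr by (intro Bochner_Integration.integrable_add integrable_mult_right)
    define F where "F = (LINT x|lborel. target r x)"
    have F: "F = c * (1 + \<kappa> / r\<^sup>2)"
      unfolding F_def target_split using int_quartic int_corr I_corr
      by (subst Bochner_Integration.integral_add) (auto simp: c_def[symmetric] algebra_simps)
    have Fc: "F \<ge> c" unfolding F using c \<kappa> by simp
    have int_bt: "integrable lborel (\<lambda>x. b x - target r x)"
      by (rule integrable_gaussian_dominated[where K = "C / r ^ 3" and k = 0]) (use b in auto)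
    have int_b: "integrable lborel b"
      using Bochner_Integration.integrable_add[OF int_bt int_target] by simp
    have FB: "\<bar>B - F\<bar> \<le> C * m0 / r ^ 3"
    proof -
      have "\<bar>LINT x|lborel. b x - target r x\<bar> \<le> C / r ^ 3 * m0"
        unfolding m0_def by (rule integral_gaussian_dominated) (use b in auto)
      then show ?thesis unfolding B_def F_def using int_b int_target by simp
    qed
    have diff: "\<bar>b x - B * q r x\<bar> \<le> K / r ^ 3 * exp (- x\<^sup>2 / 2)" for x
    proof -
      define G where "G = exp (- x\<^sup>2 / 2)"
      \<comment> \<open>Dividing by the mass \<open>1 + \<kappa> * \<epsilon>\<close> amounts to
        first order to subtracting \<open>\<kappa>\<close> from \<open>corr\<close>; only the term
        in \<open>\<epsilon> * \<epsilon>\<close>, of order \<open>1 / n\<close>, survives.\<close>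
      have "target r x - F * q r x = - (\<kappa> / r ^ 4) * (quartic x * (corr x - \<kappa>))"
      proof -
        define \<epsilon> where "\<epsilon> = 1 / r\<^sup>2"
        have "r ^ 4 = r\<^sup>2 * r\<^sup>2" by (simp add: power_add[symmetric])
        then have "1 / r ^ 4 = \<epsilon> * \<epsilon>" by (simp add: \<epsilon>_def)
        moreover have "F * q r x = quartic x * ((1 + \<kappa> * \<epsilon>) * (1 + (corr x - \<kappa>) * \<epsilon>))"
          using c by (simp add: F q_def \<epsilon>_def)
        moreover have "target r x = quartic x * (1 + corr x * \<epsilon>)" by (simp add: target_def \<epsilon>_def)
        moreover have "- (\<kappa> / r ^ 4) = - \<kappa> * (1 / r ^ 4)" by simp
        ultimately show ?thesis by (simp only:) (simp add: algebra_simps)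
      qed
      then have "\<bar>target r x - F * q r x\<bar> = \<kappa> / r ^ 4 * (quartic x * \<bar>corr x - \<kappa>\<bar>)"
        using \<kappa> r0 quartic_pos[of x] by (simp add: abs_mult)
      also have "\<dots> \<le> \<kappa> / r ^ 3 * ((1 + \<kappa>) * Q * G)"
        unfolding G_def using \<kappa> r0 r1 quartic_pos[of x]
        by (intro mult_mono Qk frac_le power_increasing) auto
      finally have 1: "\<bar>target r x - F * q r x\<bar> \<le> \<kappa> / r ^ 3 * ((1 + \<kappa>) * Q * G)" .
      have 2: "\<bar>(F - B) * q r x\<bar> \<le> C * m0 / r ^ 3 * (Kq * G)"
        unfolding abs_mult G_def using FB q_le[OF r1, of x] C(1) m r0
        by (intro mult_mono) (auto simp: abs_minus_commute)
      have "b x - B * q r x = (b x - target r x) + (target r x - F * q r x) + (F - B) * q r x"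
        by (simp add: algebra_simps)
      then have "\<bar>b x - B * q r x\<bar> \<le> C / r ^ 3 * G + \<kappa> / r ^ 3 * ((1 + \<kappa>) * Q * G) + C * m0 / r ^ 3 * (Kq * G)"
        using b[of x] 1 2 unfolding G_def[symmetric] by linarith
      also have "\<dots> = K / r ^ 3 * G"
        by (simp add: K_def add_divide_distrib algebra_simps)
      finally show ?thesis unfolding G_def .
    qed
    have bqg: "\<bar>(LINT x|lborel. b x * g x) - B * (LINT x|lborel. q r x * g x)\<bar> \<le> K * m1 / r ^ 3"
    proof -
      have dom: "\<bar>(b x - B * q r x) * g x\<bar> \<le> K / r ^ 3 * (\<bar>x\<bar> ^ 1 * exp (- x\<^sup>2 / 2))" for x
        using mult_mono[OF diff[of x] g_le[of x]] K r3 by (simp add: abs_mult mult_ac)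
      have iq: "integrable lborel (\<lambda>x. q r x * g x)"
        by (rule integrable_gaussian_dominated[where K = Kq and k = 1])
          (use mult_mono[OF q_le[OF r1] g_le] Kq in \<open>auto simp: abs_mult mult_ac\<close>)
      have id: "integrable lborel (\<lambda>x. (b x - B * q r x) * g x)"
        by (rule integrable_gaussian_dominated[OF _ dom]) simp
      have "(LINT x|lborel. b x * g x) = (LINT x|lborel. (b x - B * q r x) * g x + B * (q r x * g x))"
        by (intro Bochner_Integration.integral_cong) (auto simp: algebra_simps)
      also have "\<dots> = (LINT x|lborel. (b x - B * q r x) * g x) + B * (LINT x|lborel. q r x * g x)"
        using id iq by (subst Bochner_Integration.integral_add) auto
      finally have "(LINT x|lborel. b x * g x) - B * (LINT x|lborel. q r x * g x) = (LINT x|lborel. (b x - B * q r x) * g x)"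
        by simp
      also have "\<bar>\<dots>\<bar> \<le> K / r ^ 3 * m1"
        unfolding m1_def by (rule integral_gaussian_dominated[OF _ dom]) simp
      finally show ?thesis by simp
    qed
    have "\<bar>E - (LINT x|lborel. q r x * g x)\<bar> \<le> D * (1 / r ^ 3)"
    proof (cases "C * m0 / r ^ 3 \<le> c / 2")
      case True
      then have B2: "B \<ge> c / 2" using FB Fc by linarith
      then have B0: "B > 0" using c by linarith
      have "B * \<bar>E - (LINT x|lborel. q r x * g x)\<bar> = \<bar>B * E - B * (LINT x|lborel. q r x * g x)\<bar>"
        using B0 by (simp add: abs_mult right_diff_distrib[symmetric])
      also have "\<dots> \<le> B / r ^ 3 + K * m1 / r ^ 3"
        using bg bqg unfolding B_def[symmetric] by linarith
      \<comment> \<open>Inserting \<open>1 \<le> 2 * B / c\<close> gives every term a factor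
        \<open>B\<close>, which can then be cancelled.\<close>
      also have "\<dots> \<le> B / r ^ 3 + (2 * B / c) * (K * m1) / r ^ 3"
      proof -
        have "1 \<le> 2 * B / c" using B2 c by (simp add: field_simps)
        then have "1 * (K * m1) \<le> (2 * B / c) * (K * m1)" using K m by (intro mult_right_mono) auto
        then show ?thesis using r3 by (intro add_left_mono divide_right_mono) auto
      qed
      also have "\<dots> = B * ((1 + 2 * K * m1 / c) / r ^ 3)" by (simp add: add_divide_distrib distrib_left mult_ac)
      finally have "\<bar>E - (LINT x|lborel. q r x * g x)\<bar> \<le> (1 + 2 * K * m1 / c) / r ^ 3"
        using B0 by (rule mult_left_le_imp_le)
      also have "\<dots> \<le> D / r ^ 3"
        unfolding D_def using r3 R Kq m by (intro divide_right_mono) auto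
      finally show ?thesis by simp
    next
      case False
      then have rR: "r ^ 3 \<le> R" using c r3 by (simp add: R_def field_simps)
      have "\<bar>E\<bar> \<le> r"
      proof -
        have "\<bar>\<Sum>k\<le>n. spin_weight n k * (h ((2 * real k - real n) / r ^ 3) - h 0)\<bar> \<le> (\<Sum>k\<le>n. spin_weight n k * r)"
        proof (rule order_trans[OF sum_abs], rule sum_mono)
          fix k assume k: "k \<in> {..n}"
          have "\<bar>g ((2 * real k - real n) / r ^ 3)\<bar> \<le> \<bar>2 * real k - real n\<bar> / r ^ 3"
            using g_le[of "(2 * real k - real n) / r ^ 3"] r3 by simp
          also have "\<dots> \<le> r ^ 4 / r ^ 3" unfolding rn using k r3 by (intro divide_right_mono) auto
          also have "\<dots> = r" using r0 by (simp add: field_simps eval_nat_numeral)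
          finally show "\<bar>spin_weight n k * (h ((2 * real k - real n) / r ^ 3) - h 0)\<bar> \<le> spin_weight n k * r"
            using spin_weight_pos[of k n] k unfolding g_def by (simp add: abs_mult)
        qed
        then show ?thesis
          unfolding E_def abs_divide sum_distrib_right[symmetric] using S by (simp add: pos_divide_le_eq mult.commute)
      qed
      also have "r \<le> r ^ 3" using r1 by (rule self_le_power) simp
      also note rR
      finally have "\<bar>E - (LINT x|lborel. q r x * g x)\<bar> \<le> (R + Kq * m1) * 1"
        unfolding mult_1_right using qg by (intro order_trans[OF abs_triangle_ineq4] add_mono)
      also have "\<dots> \<le> (R + Kq * m1) * (R / r ^ 3)"
        using rR r3 R Kq m by (intro mult_left_mono) (auto simp: field_simps)
      also have "\<dots> \<le> D / r ^ 3"
        unfolding D_def using r3 K m c by (simp add: divide_right_mono)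
      finally show ?thesis by simp
    qed
    then show "\<bar>(LINT \<sigma>|curie_weiss n. h (W n \<sigma>)) - (LINT z|Z4_law. h z)
       - 1 / sqrt (real n) * (LINT z|Z4_law. e1 z * h z)\<bar> \<le> D * real n powr (- 3 / 4)"
      unfolding powr using E1 E2 by (smt (verit))
  qed
qed

end
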